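(* Let $M$ be a non-degenerate Orlicz function such that there exists a finite number $K>0$ satisfying $\lim_{t\to 0^+}M(Kt)/M(t)=\infty$. Then the Orlicz sequence space $h_M$ is isomorphically polyhedral.
   Context: All Banach spaces are real. A Banach space is polyhedral if the closed unit ball of each of its finite dimensional subspaces is a polyhedron (i.e., the convex hull of finitely many points). A Banach space is isomorphically polyhedral if it is (linearly) isomorphic to a polyhedral Banach space. An Orlicz function $M$ is a continuous non-decreasing convex function defined for $t\ge 0$ such that $M(0)=0$ and $\lim_{t\to\infty}M(t)=\infty$. It is non-degenerate if $M(t)>0$ for all $t>0$. The Orlicz sequence space $\ell_M$ is the space of all real sequences $(a_n)$ such that $\sum_n M(|a_n|/\rho)<\infty$ for some $\rho>0$, with the norm $\|(a_n)\|=\inf\{\rho>0:\sum_n M(|a_n|/\rho)\le 1\}$. Let $e_n$ be the sequence whose only nonzero coordinate is a $1$ in the $n$-th position. The space $h_M$ is the closed linear span of $\{e_n\}$ in $\ell_M$; equivalently, it is the set of all real sequences $(a_n)$ with $\sum_n M(|a_n|/\rho)<\infty$ for every $\rho>0$. *)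

theory Defs
  imports "HOL-Analysis.Analysis" "HOL-Library.Function_Algebras"
begin

instantiation "fun" :: (type, real_vector) real_vector
begin

definition "scaleR_fun c f = (\<lambda>x. c *\<^sub>R f x)" for c :: real and f :: "'a \<Rightarrow> 'b"

instance
  by standard (simp_all add: scaleR_fun_def fun_eq_iff algebra_simps)

end

text \<open>
  The type of a normed space cannot depend on a function \<open>M\<close>, so a normed space is given
  by a linear subspace \<open>V\<close> of an ambient real vector space together with a function \<open>N\<close>
  that is a norm on \<open>V\<close>; the values of \<open>N\<close> outside \<open>V\<close> are irrelevant.
\<close>

definition normed_on :: "'a::real_vector set \<Rightarrow> ('a \<Rightarrow> real) \<Rightarrow> bool" where
  "normed_on V N \<longleftrightarrow> subspace V \<and>
     (\<forall>x\<in>V. 0 \<le> N x \<and> (N x = 0 \<longleftrightarrow> x = 0)) \<and>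
     (\<forall>x\<in>V. \<forall>c. N (c *\<^sub>R x) = \<bar>c\<bar> * N x) \<and>
     (\<forall>x\<in>V. \<forall>y\<in>V. N (x + y) \<le> N x + N y)"

definition banach_on :: "'a::real_vector set \<Rightarrow> ('a \<Rightarrow> real) \<Rightarrow> bool" where
  "banach_on V N \<longleftrightarrow> normed_on V N \<and>
     (\<forall>f::nat \<Rightarrow> 'a. range f \<subseteq> V \<and>
        (\<forall>e>0. \<exists>n0. \<forall>m\<ge>n0. \<forall>n\<ge>n0. N (f m - f n) < e) \<longrightarrow>
        (\<exists>l\<in>V. (\<lambda>n. N (f n - l)) \<longlonglongrightarrow> 0))"

text \<open>The finite-dimensional subspaces of \<open>V\<close> are the spans of its finite subsets.\<close>

definition polyhedral_on :: "'a::real_vector set \<Rightarrow> ('a \<Rightarrow> real) \<Rightarrow> bool" where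
  "polyhedral_on V N \<longleftrightarrow>
     (\<forall>B. finite B \<and> B \<subseteq> V \<longrightarrow> polytope {x \<in> span B. N x \<le> 1})"

definition isomorphism_on ::
  "'a::real_vector set \<Rightarrow> ('a \<Rightarrow> real) \<Rightarrow> 'b::real_vector set \<Rightarrow> ('b \<Rightarrow> real) \<Rightarrow> ('a \<Rightarrow> 'b) \<Rightarrow> bool" where
  "isomorphism_on V N W N' T \<longleftrightarrow> bij_betw T V W \<and>
     (\<forall>x\<in>V. \<forall>y\<in>V. T (x + y) = T x + T y) \<and>
     (\<forall>x\<in>V. \<forall>c. T (c *\<^sub>R x) = c *\<^sub>R T x) \<and>
     (\<exists>C>0. \<forall>x\<in>V. N' (T x) \<le> C * N x) \<and>
     (\<exists>C>0. \<forall>x\<in>V. N x \<le> C * N' (T x))"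

text \<open>
  HOL cannot quantify over types, so the polyhedral space here has the same ambient type as
  \<open>V\<close>. This is no restriction: see \<open>isomorphically_polyhedral_onI\<close> below.
\<close>

definition isomorphically_polyhedral_on :: "'a::real_vector set \<Rightarrow> ('a \<Rightarrow> real) \<Rightarrow> bool" where
  "isomorphically_polyhedral_on V N \<longleftrightarrow> banach_on V N \<and>
     (\<exists>(W :: 'a set) N' T. banach_on W N' \<and> polyhedral_on W N' \<and> isomorphism_on V N W N' T)"

lemma isomorphically_polyhedral_onI:
  fixes V :: "'a::real_vector set" and W :: "'b::real_vector set"
  assumes V: "banach_on V N" and W: "banach_on W N'" and P: "polyhedral_on W N'"
    and T: "isomorphism_on V N W N' T"
  shows "isomorphically_polyhedral_on V N"
proof -
  have sV: "subspace V" and nW: "normed_on W N'" and sW: "subspace W"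
    using V W by (auto simp: banach_on_def normed_on_def)
  have bij: "bij_betw T V W"
    and add: "\<And>x y. x \<in> V \<Longrightarrow> y \<in> V \<Longrightarrow> T (x + y) = T x + T y"
    and scale: "\<And>x c. x \<in> V \<Longrightarrow> T (c *\<^sub>R x) = c *\<^sub>R T x"
    using T by (auto simp: isomorphism_on_def)
  have TW: "T x \<in> W" if "x \<in> V" for x
    using bij that by (auto simp: bij_betw_def)
  have T0: "T 0 = 0"
    using scale[of 0 0] subspace_0[OF sV] by simp
  have inj: "T x = T y \<longleftrightarrow> x = y" if "x \<in> V" "y \<in> V" for x y
    using bij that by (auto simp: bij_betw_def inj_on_def)
  have diff: "T (x - y) = T x - T y" if "x \<in> V" "y \<in> V" for x y
    using add[of "x - y" y] that sV by (simp add: subspace_diff)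
  let ?N = "\<lambda>x. N' (T x)"
  have norm: "normed_on V ?N"
    unfolding normed_on_def
  proof (intro conjI ballI allI)
    fix x assume x: "x \<in> V"
    show "0 \<le> ?N x" using nW TW[OF x] by (auto simp: normed_on_def)
    show "?N x = 0 \<longleftrightarrow> x = 0"
      using nW TW[OF x] inj[OF x subspace_0[OF sV]] T0 by (auto simp: normed_on_def)
    show "?N (c *\<^sub>R x) = \<bar>c\<bar> * ?N x" for c
      using nW TW[OF x] scale[OF x] by (auto simp: normed_on_def)
    show "?N (x + y) \<le> ?N x + ?N y" if "y \<in> V" for y
      using nW TW[OF x] TW[OF that] add[OF x that] by (auto simp: normed_on_def)
  qed (rule sV)
  have ban: "banach_on V ?N"
    unfolding banach_on_def
  proof (intro conjI allI impI)
    fix f :: "nat \<Rightarrow> 'a"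
    assume *: "range f \<subseteq> V \<and> (\<forall>e>0. \<exists>n0. \<forall>m\<ge>n0. \<forall>n\<ge>n0. ?N (f m - f n) < e)"
    then have f: "f n \<in> V" for n by auto
    have "range (T \<circ> f) \<subseteq> W" using f TW by auto
    moreover have "\<forall>e>0. \<exists>n0. \<forall>m\<ge>n0. \<forall>n\<ge>n0. N' ((T \<circ> f) m - (T \<circ> f) n) < e"
      using * by (simp add: diff[OF f f])
    ultimately obtain l where l: "l \<in> W" "(\<lambda>n. N' ((T \<circ> f) n - l)) \<longlonglongrightarrow> 0"
      using W unfolding banach_on_def by blast
    obtain k where k: "k \<in> V" "l = T k"
      using l(1) bij by (auto simp: bij_betw_def)
    show "\<exists>l\<in>V. (\<lambda>n. ?N (f n - l)) \<longlonglongrightarrow> 0"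
      using l(2) k by (intro bexI[of _ k]) (simp_all add: diff[OF f k(1)])
  qed (rule norm)
  have pol: "polyhedral_on V ?N"
    unfolding polyhedral_on_def
  proof (intro allI impI)
    fix B assume B: "finite B \<and> B \<subseteq> V"
    obtain D where D: "D \<subseteq> B" "independent D" "B \<subseteq> span D"
      by (rule maximal_independent_subset)
    have sp: "span B = span D"
      using D by (meson span_minimal span_mono subset_antisym subspace_span)
    have DV: "D \<subseteq> V" and fD: "finite D"
      using D(1) B finite_subset by auto
    have spV: "span D \<subseteq> V"
      by (rule span_minimal[OF DV sV])
    obtain g where g: "linear g" "\<forall>x\<in>D. g x = T x"
      using linear_independent_extend[OF D(2), of T] by blast
    have "x \<in> V \<and> g x = T x" if "x \<in> span D" for x
      using that
    proof (induction rule: span_induct_alt)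
      case base
      show ?case using g T0 sV by (auto simp: linear_0 subspace_0)
    next
      case (step c x y)
      then have "x \<in> V" using DV by auto
      then show ?case using step g sV
        by (auto simp: linear_add linear_scale add scale subspace_add subspace_scale)
    qed
    then have gT: "g x = T x" if "x \<in> span D" for x using that by blast
    have gi: "inj_on g (span D)"
      using gT inj[OF subsetD[OF spV] subsetD[OF spV]] by (simp add: inj_on_def)
    obtain h where h: "linear h" "\<forall>x\<in>span D. h (g x) = x"
      using linear_exists_left_inverse_on[OF g(1) subspace_span gi] by blast
    have "g ` D = T ` D"
      using g(2) by (intro image_cong) auto
    then have im: "g ` span D = span (T ` D)"
      using linear_span_image[OF g(1), of D] by simp
    have "T ` D \<subseteq> W" using DV TW by auto
    then have "polytope {x \<in> span (T ` D). N' x \<le> 1}"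
      using P fD by (auto simp: polyhedral_on_def)
    then have "polytope (h ` {x \<in> span (T ` D). N' x \<le> 1})"
      by (rule polytope_linear_image[OF h(1)])
    also have "h ` {x \<in> span (T ` D). N' x \<le> 1} = {x \<in> span B. ?N x \<le> 1}"
    proof (intro equalityI subsetI)
      fix y assume "y \<in> h ` {x \<in> span (T ` D). N' x \<le> 1}"
      then obtain x where "x \<in> span D" "N' (g x) \<le> 1" "y = h (g x)"
        unfolding im[symmetric] by blast
      then show "y \<in> {x \<in> span B. ?N x \<le> 1}"
        using h(2) gT sp by simp
    next
      fix x assume "x \<in> {x \<in> span B. ?N x \<le> 1}"
      then have "x \<in> span D" "N' (g x) \<le> 1" "h (g x) = x"
        using h(2) gT sp by auto
      then show "x \<in> h ` {x \<in> span (T ` D). N' x \<le> 1}"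
        unfolding im[symmetric] by (intro image_eqI[of _ _ "g x"]) auto
    qed
    finally show "polytope {x \<in> span B. ?N x \<le> 1}" .
  qed
  have "isomorphism_on V N V ?N id"
    using T by (auto simp: isomorphism_on_def)
  with V ban pol show ?thesis
    unfolding isomorphically_polyhedral_on_def by blast
qed

text \<open>Orlicz functions live on \<open>{0..}\<close>; the values of \<open>M\<close> at negative reals are irrelevant.\<close>

definition orlicz_function :: "(real \<Rightarrow> real) \<Rightarrow> bool" where
  "orlicz_function M \<longleftrightarrow> continuous_on {0..} M \<and> mono_on {0..} M \<and> convex_on {0..} M \<and>
     M 0 = 0 \<and> filterlim M at_top at_top"

definition nondegenerate :: "(real \<Rightarrow> real) \<Rightarrow> bool" where
  "nondegenerate M \<longleftrightarrow> (\<forall>t>0. M t > 0)"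

definition orlicz_space :: "(real \<Rightarrow> real) \<Rightarrow> (nat \<Rightarrow> real) set" where
  "orlicz_space M = {a. \<exists>\<rho>>0. summable (\<lambda>n. M (\<bar>a n\<bar> / \<rho>))}"

definition orlicz_norm :: "(real \<Rightarrow> real) \<Rightarrow> (nat \<Rightarrow> real) \<Rightarrow> real" where
  "orlicz_norm M a =
     Inf {\<rho>. \<rho> > 0 \<and> summable (\<lambda>n. M (\<bar>a n\<bar> / \<rho>)) \<and> (\<Sum>n. M (\<bar>a n\<bar> / \<rho>)) \<le> 1}"

definition unit_seq :: "nat \<Rightarrow> nat \<Rightarrow> real" where
  "unit_seq n = (\<lambda>k. if k = n then 1 else 0)"

definition orlicz_h :: "(real \<Rightarrow> real) \<Rightarrow> (nat \<Rightarrow> real) set" where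
  "orlicz_h M = {a \<in> orlicz_space M.
     \<forall>e>0. \<exists>b \<in> span (range unit_seq). orlicz_norm M (a - b) < e}"

end

theory Submission
  imports Defs
begin

text \<open>
  Replacing \<open>K\<close> by \<open>max K 2\<close>, minorise \<open>M\<close> by the positive parts of its secants through the
  points \<open>(s, M s)\<close>, \<open>s = K\<^sup>-\<^sup>j\<close>, with slope \<open>M s / s\<close>. The maximum \<open>\<phi>\<^sub>k\<close> of the first \<open>J k\<close> of them is
  piecewise linear and vanishes near \<open>0\<close>, and the supremum over \<open>k\<close> is equivalent to \<open>M\<close> up to
  a dilation. The equivalent norm has the unit ball \<open>\<Sum>\<^sub>n \<phi>\<^sub>k \<bar>x n\<bar> \<le> 2 - 2\<^sup>-\<^sup>k\<close> for all \<open>k\<close>.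
  The growth hypothesis lets one choose \<open>J\<close> with \<open>\<phi>\<^sub>k\<^sub>+\<^sub>1 t \<le> \<phi>\<^sub>k t + 4\<^sup>-\<^sup>k M (K t)\<close>. Since
  \<open>\<Sum>\<^sub>n M (K \<bar>v n\<bar>) < \<infinity>\<close> for \<open>v \<in> h\<^sub>M\<close>, on the sequences dominated by \<open>v\<close> all but finitely many of
  these constraints follow from the others, and each of them involves only finitely many
  coordinates. The bounded subsets of a finite dimensional subspace are dominated by a single
  element of \<open>h\<^sub>M\<close>, so its unit ball is an intersection of finitely many half-spaces.
\<close>

subsection \<open>Polytopes in real vector spaces\<close>

text \<open>Minkowski-Weyl without a topology: \<open>rec\<close> excludes recession directions, so
  from a point that is not a vertex one can move both ways inside its face until a further
  constraint becomes active. Induction on the number of inactive constraints writes every point as a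
  convex combination of vertices.\<close>

lemma polytope_of_halfspaces:
  fixes V :: "'a::real_vector set" and f :: "'i \<Rightarrow> 'a \<Rightarrow> real"
  assumes V: "subspace V" and I: "finite I"
    and lin: "\<And>i. i \<in> I \<Longrightarrow> linear (f i)"
    and rec: "\<And>d. d \<in> V \<Longrightarrow> d \<noteq> 0 \<Longrightarrow> \<exists>i\<in>I. f i d > 0"
  shows "polytope {x \<in> V. \<forall>i\<in>I. f i x \<le> c i}"
proof -
  define P where "P = {x \<in> V. \<forall>i\<in>I. f i x \<le> c i}"
  define act where "act x = {i\<in>I. f i x = c i}" for x
  \<comment> \<open>Vertices: points determined in \<open>V\<close> by their active constraints.
    Hence \<open>act\<close> is injective on them and there are finitely many.\<close>
  define W where "W = {x \<in> P. \<forall>y\<in>V. (\<forall>i\<in>act x. f i y = c i) \<longrightarrow> y = x}"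
  have "inj_on act W"
    unfolding inj_on_def W_def P_def by (auto simp: act_def)
  moreover have "act ` W \<subseteq> Pow I" by (auto simp: act_def)
  ultimately have finW: "finite W"
    using I by (meson finite_Pow_iff finite_imageD finite_subset)
  have move: "\<exists>s>0. x + s *\<^sub>R d \<in> P \<and> act x \<subset> act (x + s *\<^sub>R d)"
    if x: "x \<in> P" and d: "d \<in> V" "d \<noteq> 0" and a: "\<forall>i\<in>act x. f i d = 0" for x d
  proof -
    define Q where "Q = {i\<in>I. f i d > 0}"
    \<comment> \<open>Ratio test: \<open>r i\<close> is the step length at which constraint
      \<open>i\<close> becomes active, and the smallest of them is the longest step that stays in
      \<open>P\<close>.\<close>
    define r where "r i = (c i - f i x) / f i d" for i
    have Q: "finite Q" "Q \<noteq> {}" using I rec[OF d] by (auto simp: Q_def)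
    define s where "s = Min (r ` Q)"
    obtain j where j: "j \<in> Q" "s = r j"
      using Min_in[of "r ` Q"] Q unfolding s_def by blast
    have sle: "s \<le> r i" if "i \<in> Q" for i using that Q unfolding s_def by auto
    have fe: "f i (x + t *\<^sub>R d) = f i x + t * f i d" if "i \<in> I" for i t
      using lin[OF that] by (simp add: linear_add linear_scale)
    have jn: "j \<notin> act x" using j a by (auto simp: Q_def)
    have s0: "s > 0"
      using j jn x by (auto simp: Q_def r_def act_def P_def less_le)
    have "f i x + s * f i d \<le> c i" if i: "i \<in> I" for i
    proof (cases "i \<in> Q")
      case True
      then show ?thesis using sle[OF True] by (auto simp: r_def Q_def field_simps)
    next
      case False
      then have "s * f i d \<le> 0" using i s0 by (simp add: Q_def mult_le_0_iff)
      then show ?thesis using x i by (force simp: P_def)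
    qed
    then have "x + s *\<^sub>R d \<in> P"
      using x d V fe by (auto simp: P_def subspace_add subspace_scale)
    moreover have "j \<in> act (x + s *\<^sub>R d)"
      using j fe by (auto simp: act_def Q_def r_def)
    moreover have "act x \<subseteq> act (x + s *\<^sub>R d)"
      using a fe by (auto simp: act_def)
    ultimately show ?thesis using s0 jn by blast
  qed
  have "x \<in> convex hull W" if "x \<in> P" for x
    using that
  proof (induction "card (I - act x)" arbitrary: x rule: less_induct)
    case less
    show ?case
    proof (cases "x \<in> W")
      case True then show ?thesis by (simp add: hull_inc)
    next
      case False
      then obtain y where y: "y \<in> V" "\<forall>i\<in>act x. f i y = c i" "y \<noteq> x"
        using less.prems by (auto simp: W_def)
      define d where "d = y - x"
      have d: "d \<in> V" "d \<noteq> 0" "\<forall>i\<in>act x. f i d = 0"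
        using y less.prems V lin by (auto simp: d_def P_def subspace_diff act_def linear_diff)
      have d': "-d \<in> V" "-d \<noteq> 0" "\<forall>i\<in>act x. f i (-d) = 0"
        using d V lin by (auto simp: subspace_neg act_def linear_neg)
      have smaller: "card (I - act z) < card (I - act x)" if "act x \<subset> act z" for z
        using that I by (intro psubset_card_mono) (auto simp: act_def)
      obtain s where s: "s > 0" "x + s *\<^sub>R d \<in> P" "act x \<subset> act (x + s *\<^sub>R d)"
        using move[OF less.prems d] by blast
      obtain t where t: "t > 0" "x + t *\<^sub>R (-d) \<in> P" "act x \<subset> act (x + t *\<^sub>R (-d))"
        using move[OF less.prems d'] by blast
      have hs: "x + s *\<^sub>R d \<in> convex hull W" and ht: "x + t *\<^sub>R (-d) \<in> convex hull W"
        using less.hyps smaller s t by blast+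
      have one: "t / (s + t) + s / (s + t) = 1"
        using s(1) t(1) by (simp flip: add_divide_distrib)
      \<comment> \<open>The point \<open>x\<close> divides the segment between the two exit points
        in the ratio \<open>s : t\<close>, which dictates the weights.\<close>
      have "(t / (s + t)) *\<^sub>R (x + s *\<^sub>R d) + (s / (s + t)) *\<^sub>R (x + t *\<^sub>R (-d)) \<in> convex hull W"
        using hs ht s(1) t(1) one by (intro convexD convex_convex_hull) auto
      also have "(t / (s + t)) *\<^sub>R (x + s *\<^sub>R d) + (s / (s + t)) *\<^sub>R (x + t *\<^sub>R (-d))
          = (t / (s + t) + s / (s + t)) *\<^sub>R x"
        by (simp add: algebra_simps)
      finally show ?thesis by (simp add: one)
    qed
  qed
  moreover have "convex hull W \<subseteq> P"
  proof (rule hull_minimal)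
    show "W \<subseteq> P" by (auto simp: W_def)
    show "convex P"
      unfolding convex_def
    proof (intro ballI allI impI)
      fix x y :: 'a and u v :: real
      assume *: "x \<in> P" "y \<in> P" "0 \<le> u" "0 \<le> v" "u + v = 1"
      have "f i (u *\<^sub>R x + v *\<^sub>R y) \<le> c i" if i: "i \<in> I" for i
      proof -
        have "f i (u *\<^sub>R x + v *\<^sub>R y) = u * f i x + v * f i y"
          using lin[OF i] by (simp add: linear_add linear_scale)
        also have "\<dots> \<le> u * c i + v * c i"
          using * i by (intro add_mono mult_left_mono) (auto simp: P_def)
        also have "\<dots> = c i" using *(5) by (metis distrib_right mult_1)
        finally show ?thesis .
      qed
      then show "u *\<^sub>R x + v *\<^sub>R y \<in> P"
        using * V by (auto simp: P_def subspace_add subspace_scale)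
    qed
  qed
  ultimately have "P = convex hull W" by blast
  then show ?thesis
    using finW unfolding polytope_def P_def by blast
qed

text \<open>Stating finite maxima of affine functionals through their sublevel sets makes
  closure under sums and maxima immediate.\<close>

definition max_affine :: "('a::real_vector \<Rightarrow> real) \<Rightarrow> bool" where
  "max_affine F \<longleftrightarrow> (\<exists>A. finite A \<and> (\<forall>(f, a)\<in>A. linear f) \<and>
     (\<forall>x r. F x \<le> r \<longleftrightarrow> (\<forall>(f, a)\<in>A. f x + a \<le> (r::real))))"

lemma max_affine_affine:
  assumes "linear f" shows "max_affine (\<lambda>x. f x + a)"
  unfolding max_affine_def using assms by (intro exI[of _ "{(f, a)}"]) auto

lemma max_affine_const: "max_affine (\<lambda>x. a)"
  using max_affine_affine[OF linear_zero, of a] by simp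

lemma max_affine_max:
  assumes "max_affine F" "max_affine G"
  shows "max_affine (\<lambda>x. max (F x) (G x))"
proof -
  obtain A where A: "finite A" "\<forall>(f, a)\<in>A. linear f"
    "\<And>x r. F x \<le> r \<longleftrightarrow> (\<forall>(f, a)\<in>A. f x + a \<le> r)"
    using assms(1) unfolding max_affine_def by blast
  obtain B where B: "finite B" "\<forall>(f, a)\<in>B. linear f"
    "\<And>x r. G x \<le> r \<longleftrightarrow> (\<forall>(f, a)\<in>B. f x + a \<le> r)"
    using assms(2) unfolding max_affine_def by blast
  show ?thesis
    unfolding max_affine_def
    by (rule exI[of _ "A \<union> B"]) (use A(1,2) B(1,2) in \<open>auto simp: A(3) B(3)\<close>)
qed

text \<open>A sum of two maxima is the maximum of all pairwise sums of pieces.\<close>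

lemma max_affine_add:
  assumes "max_affine F" "max_affine G"
  shows "max_affine (\<lambda>x. F x + G x)"
proof -
  obtain A where A: "finite A" "\<forall>(f, a)\<in>A. linear f"
    "\<And>x r. F x \<le> r \<longleftrightarrow> (\<forall>(f, a)\<in>A. f x + a \<le> r)"
    using assms(1) unfolding max_affine_def by blast
  obtain B where B: "finite B" "\<forall>(f, a)\<in>B. linear f"
    "\<And>x r. G x \<le> r \<longleftrightarrow> (\<forall>(f, a)\<in>B. f x + a \<le> r)"
    using assms(2) unfolding max_affine_def by blast
  let ?C = "(\<lambda>((f, a), (g, b)). (\<lambda>x. f x + g x, a + b)) ` (A \<times> B)"
  have "F x + G x \<le> r \<longleftrightarrow> (\<forall>(f, a)\<in>?C. f x + a \<le> r)" for x r
  proof -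
    have "F x + G x \<le> r \<longleftrightarrow> F x \<le> r - G x" by linarith
    also have "\<dots> \<longleftrightarrow> (\<forall>(f, a)\<in>A. G x \<le> r - (f x + a))"
      unfolding A(3) by (auto simp: algebra_simps)
    also have "\<dots> \<longleftrightarrow> (\<forall>(f, a)\<in>A. \<forall>(g, b)\<in>B. g x + b \<le> r - (f x + a))"
      unfolding B(3) by blast
    also have "\<dots> \<longleftrightarrow> (\<forall>(f, a)\<in>?C. f x + a \<le> r)"
      by (fastforce simp: split_beta algebra_simps)
    finally show ?thesis .
  qed
  moreover have "\<forall>(f, a)\<in>?C. linear f"
    using A(2) B(2) by (auto intro!: linear_compose_add)
  ultimately show ?thesis
    unfolding max_affine_def using A(1) B(1) by (intro exI[of _ ?C]) blast
qed

lemma max_affine_sum: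
  assumes "finite I" "\<And>i. i \<in> I \<Longrightarrow> max_affine (F i)"
  shows "max_affine (\<lambda>x. \<Sum>i\<in>I. F i x)"
  using assms by (induction rule: finite_induct) (auto intro: max_affine_const max_affine_add)

text \<open>Each piece \<open>(f, a)\<close> of \<open>F i\<close> becomes the half-space
  \<open>f x \<le> c i - a\<close>. Feasibility of the origin gives \<open>a \<le> c i\<close>, so a
  piece violated at a positive multiple of \<open>d\<close> has \<open>f d > 0\<close>. Leaving the
  set along every ray therefore excludes recession directions.\<close>

lemma polytope_of_max_affine:
  fixes V :: "'a::real_vector set" and F :: "'i \<Rightarrow> 'a \<Rightarrow> real"
  assumes V: "subspace V" and I: "finite I"
    and F: "\<And>i. i \<in> I \<Longrightarrow> max_affine (F i)"
    and zero: "\<And>i. i \<in> I \<Longrightarrow> F i 0 \<le> c i"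
    and rec: "\<And>d. d \<in> V \<Longrightarrow> d \<noteq> 0 \<Longrightarrow> \<exists>t>0. \<exists>i\<in>I. F i (t *\<^sub>R d) > c i"
  shows "polytope {x \<in> V. \<forall>i\<in>I. F i x \<le> c i}"
proof -
  obtain A where A: "\<And>i. i \<in> I \<Longrightarrow> finite (A i)"
    "\<And>i f a. i \<in> I \<Longrightarrow> (f, a) \<in> A i \<Longrightarrow> linear f"
    "\<And>i x r. i \<in> I \<Longrightarrow> F i x \<le> r \<longleftrightarrow> (\<forall>(f, a)\<in>A i. f x + a \<le> r)"
  proof -
    have "\<forall>i\<in>I. \<exists>A. finite A \<and> (\<forall>(f, a)\<in>A. linear f) \<and>
       (\<forall>x r. F i x \<le> r \<longleftrightarrow> (\<forall>(f, a)\<in>A. f x + a \<le> r))"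
      using F unfolding max_affine_def by blast
    from bchoice[OF this] show ?thesis using that by (smt (verit) case_prodD)
  qed
  let ?S = "SIGMA i:I. A i"
  have "polytope {x \<in> V. \<forall>s\<in>?S. (\<lambda>(i, f, a). f) s x \<le> (\<lambda>(i, f, a). c i - a) s}"
  proof (rule polytope_of_halfspaces[OF V])
    show "finite ?S" using I A(1) by auto
    show "linear ((\<lambda>(i, f, a). f) s)" if "s \<in> ?S" for s
      using that A(2) by auto
    show "\<exists>s\<in>?S. 0 < (\<lambda>(i, f, a). f) s d" if d: "d \<in> V" "d \<noteq> 0" for d
    proof -
      obtain t i where t: "t > 0" "i \<in> I" "\<not> F i (t *\<^sub>R d) \<le> c i"
        using rec[OF d] by (auto simp: not_le)
      then obtain f a where f: "(f, a) \<in> A i" "f (t *\<^sub>R d) + a > c i"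
        using A(3) by (auto simp: not_le)
      have l: "linear f" using A(2) t f by blast
      have "f 0 + a \<le> c i" using A(3)[OF t(2)] zero[OF t(2)] f(1) by blast
      then have "t * f d > 0" using f(2) l by (simp add: linear_scale linear_0)
      then have "f d > 0" using t(1) by (simp add: zero_less_mult_iff)
      then show ?thesis using f t by (intro bexI[of _ "(i, f, a)"]) auto
    qed
  qed
  also have "{x \<in> V. \<forall>s\<in>?S. (\<lambda>(i, f, a). f) s x \<le> (\<lambda>(i, f, a). c i - a) s}
      = {x \<in> V. \<forall>i\<in>I. F i x \<le> c i}"
    using A(3) by (fastforce simp: algebra_simps)
  finally show ?thesis .
qed

subsection \<open>Minkowski functionals\<close>

definition minkowski :: "'a::real_vector set \<Rightarrow> 'a \<Rightarrow> real" where
  "minkowski B x = Inf {\<rho>. \<rho> > 0 \<and> (1 / \<rho>) *\<^sub>R x \<in> B}"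

text \<open>Boundedness and closedness are required along rays only, since the ambient space carries
  no topology. The set \<open>B\<close> need not lie in \<open>V\<close>: a modular ball may contain
  sequences outside \<open>h_M\<close>.\<close>

locale norm_ball =
  fixes V B :: "'a::real_vector set"
  assumes V: "subspace V" and conv: "convex B" and sym: "\<And>x. x \<in> B \<Longrightarrow> - x \<in> B"
    and absorbing: "\<And>x. x \<in> V \<Longrightarrow> \<exists>\<rho>>0. (1 / \<rho>) *\<^sub>R x \<in> B"
    and bounded: "\<And>x. x \<in> V \<Longrightarrow> x \<noteq> 0 \<Longrightarrow> \<exists>e>0. \<forall>\<rho>>0. (1 / \<rho>) *\<^sub>R x \<in> B \<longrightarrow> e \<le> \<rho>"
    and closed: "\<And>x. (\<And>\<rho>. \<rho> > 1 \<Longrightarrow> (1 / \<rho>) *\<^sub>R x \<in> B) \<Longrightarrow> x \<in> B"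
begin

lemma zero_mem: "0 \<in> B"
  using absorbing[OF subspace_0[OF V]] by auto

lemma shrink: "x \<in> B \<Longrightarrow> 0 \<le> s \<Longrightarrow> s \<le> 1 \<Longrightarrow> s *\<^sub>R x \<in> B"
  using convexD[OF conv _ zero_mem, of x s "1 - s"] by simp

lemma bdd: "bdd_below {\<rho>. \<rho> > 0 \<and> (1 / \<rho>) *\<^sub>R x \<in> B}"
  by (rule bdd_belowI[of _ 0]) auto

lemma minkowski_le: "\<rho> > 0 \<Longrightarrow> (1 / \<rho>) *\<^sub>R x \<in> B \<Longrightarrow> minkowski B x \<le> \<rho>"
  unfolding minkowski_def by (rule cInf_lower[OF _ bdd]) simp

lemma minkowski_nonneg: "x \<in> V \<Longrightarrow> 0 \<le> minkowski B x"
  unfolding minkowski_def using absorbing by (intro cInf_greatest) auto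

lemma minkowski_greatest:
  assumes "x \<in> V" "\<And>\<rho>. \<rho> > 0 \<Longrightarrow> (1 / \<rho>) *\<^sub>R x \<in> B \<Longrightarrow> e \<le> \<rho>"
  shows "e \<le> minkowski B x"
  unfolding minkowski_def using absorbing[OF assms(1)] assms(2) by (intro cInf_greatest) auto

lemma minkowski_less_mem:
  assumes "x \<in> V" "minkowski B x < \<rho>"
  shows "(1 / \<rho>) *\<^sub>R x \<in> B"
proof -
  obtain \<sigma> where \<sigma>: "0 < \<sigma>" "\<sigma> < \<rho>" "(1 / \<sigma>) *\<^sub>R x \<in> B"
    using minkowski_greatest[OF assms(1), of \<rho>] assms(2) by (meson not_le)
  then have "(\<sigma> / \<rho>) *\<^sub>R ((1 / \<sigma>) *\<^sub>R x) \<in> B" by (intro shrink[OF \<sigma>(3)]) auto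
  then show ?thesis using \<sigma> by simp
qed

text \<open>Radial closedness turns the strict inequality of \<open>minkowski_less_mem\<close> into
  a weak one, so within \<open>V\<close> the unit ball of the gauge is exactly
  \<open>B\<close>.\<close>

lemma minkowski_mem:
  assumes x: "x \<in> V" "minkowski B x \<le> \<rho>" and \<rho>: "\<rho> > 0"
  shows "(1 / \<rho>) *\<^sub>R x \<in> B"
proof (rule closed)
  fix \<sigma> :: real assume "\<sigma> > 1"
  then have "minkowski B x < \<rho> * \<sigma>" using x \<rho> by (smt (verit) mult_less_cancel_left1)
  then show "(1 / \<sigma>) *\<^sub>R ((1 / \<rho>) *\<^sub>R x) \<in> B"
    using minkowski_less_mem[OF x(1)] by (simp add: field_simps)
qed

lemma minkowski_le_iff:
  assumes "x \<in> V" "\<rho> > 0"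
  shows "minkowski B x \<le> \<rho> \<longleftrightarrow> (1 / \<rho>) *\<^sub>R x \<in> B"
  using minkowski_mem minkowski_le assms by blast

lemma minkowski_scale_pos:
  assumes x: "x \<in> V" and c: "c > 0"
  shows "minkowski B (c *\<^sub>R x) \<le> c * minkowski B x"
proof (rule field_le_epsilon)
  fix e :: real assume e: "e > 0"
  define \<rho> where "\<rho> = minkowski B x + e / c"
  have "\<rho> > 0" using minkowski_nonneg[OF x] e c by (simp add: \<rho>_def add_nonneg_pos)
  moreover have "(1 / \<rho>) *\<^sub>R x \<in> B"
    using e c by (intro minkowski_less_mem[OF x]) (simp add: \<rho>_def)
  ultimately have "minkowski B (c *\<^sub>R x) \<le> c * \<rho>"
    using c by (intro minkowski_le) auto
  then show "minkowski B (c *\<^sub>R x) \<le> c * minkowski B x + e"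
    using c by (simp add: \<rho>_def distrib_left)
qed

lemma minkowski_neg: "minkowski B (- x) = minkowski B x"
proof -
  have "- y \<in> B \<longleftrightarrow> y \<in> B" for y using sym[of y] sym[of "- y"] by auto
  then show ?thesis by (simp add: minkowski_def)
qed

lemma minkowski_zero: "minkowski B 0 = 0"
proof (rule antisym)
  show "minkowski B 0 \<le> 0"
    by (rule field_le_epsilon) (simp add: minkowski_le zero_mem)
qed (rule minkowski_nonneg[OF subspace_0[OF V]])

lemma normed_on_minkowski: "normed_on V (minkowski B)"
  unfolding normed_on_def
proof (intro conjI ballI allI)
  show "subspace V" by (rule V)
next
  fix x assume x: "x \<in> V"
  show "0 \<le> minkowski B x" by (rule minkowski_nonneg[OF x])
  show "minkowski B x = 0 \<longleftrightarrow> x = 0"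
  proof
    assume 0: "minkowski B x = 0"
    show "x = 0"
    proof (rule ccontr)
      assume "x \<noteq> 0"
      then obtain e where "e > 0" "\<And>\<rho>. \<rho> > 0 \<Longrightarrow> (1 / \<rho>) *\<^sub>R x \<in> B \<Longrightarrow> e \<le> \<rho>"
        using bounded[OF x] by blast
      then show False using minkowski_greatest[OF x, of e] 0 by simp
    qed
  qed (simp add: minkowski_zero)
  show "minkowski B (c *\<^sub>R x) = \<bar>c\<bar> * minkowski B x" for c
  proof -
    have pos: "minkowski B (c *\<^sub>R x) = c * minkowski B x" if c: "c > 0" for c
    proof (rule antisym)
      \<comment> \<open>The reverse bound is \<open>minkowski_scale_pos\<close> for the vector
        \<open>c *\<^sub>R x\<close> and the factor \<open>1 / c\<close>.\<close>
      have "minkowski B x \<le> (1 / c) * minkowski B (c *\<^sub>R x)"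
        using minkowski_scale_pos[of "c *\<^sub>R x" "1 / c"] c x V by (simp add: subspace_scale)
      then show "c * minkowski B x \<le> minkowski B (c *\<^sub>R x)"
        using c by (simp add: field_simps)
    qed (rule minkowski_scale_pos[OF x c])
    show ?thesis
    proof (cases "c = 0")
      case False
      have "minkowski B (c *\<^sub>R x) = minkowski B (\<bar>c\<bar> *\<^sub>R x)"
        using minkowski_neg[of "c *\<^sub>R x"] by (simp add: abs_if)
      then show ?thesis using pos[of "\<bar>c\<bar>"] False by simp
    qed (simp add: minkowski_zero)
  qed
  show "minkowski B (x + y) \<le> minkowski B x + minkowski B y" if y: "y \<in> V" for y
  proof (rule field_le_epsilon)
    fix e :: real assume e: "e > 0"
    define \<rho> \<sigma> where "\<rho> = minkowski B x + e / 2" and "\<sigma> = minkowski B y + e / 2"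
    have pos: "\<rho> > 0" "\<sigma> > 0"
      using minkowski_nonneg[OF x] minkowski_nonneg[OF y] e by (auto simp: \<rho>_def \<sigma>_def)
    have "(1 / \<rho>) *\<^sub>R x \<in> B" "(1 / \<sigma>) *\<^sub>R y \<in> B"
      using e by (auto intro!: minkowski_less_mem x y simp: \<rho>_def \<sigma>_def)
    \<comment> \<open>These weights make the convex combination equal to
      \<open>(x + y) / (\<rho> + \<sigma>)\<close>.\<close>
    then have "(\<rho> / (\<rho> + \<sigma>)) *\<^sub>R ((1 / \<rho>) *\<^sub>R x) + (\<sigma> / (\<rho> + \<sigma>)) *\<^sub>R ((1 / \<sigma>) *\<^sub>R y) \<in> B"
      using pos by (intro convexD[OF conv]) (auto simp flip: add_divide_distrib)
    then have "(1 / (\<rho> + \<sigma>)) *\<^sub>R (x + y) \<in> B"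
      using pos by (simp add: scaleR_add_right)
    then have "minkowski B (x + y) \<le> \<rho> + \<sigma>"
      using pos by (intro minkowski_le) auto
    then show "minkowski B (x + y) \<le> minkowski B x + minkowski B y + e"
      by (simp add: \<rho>_def \<sigma>_def)
  qed
qed

end

section \<open>Comparison of gauges and transfer of completeness\<close>

lemma minkowski_mono:
  assumes B: "norm_ball V B" and B': "norm_ball V B'" and C: "C > 0"
    and incl: "\<And>x. x \<in> B \<Longrightarrow> (1 / C) *\<^sub>R x \<in> B'" and x: "x \<in> V"
  shows "minkowski B' x \<le> C * minkowski B x"
proof (rule field_le_epsilon)
  fix e :: real assume e: "e > 0"
  define \<rho> where "\<rho> = minkowski B x + e / C"
  have "\<rho> > 0"
    using norm_ball.minkowski_nonneg[OF B x] e C by (simp add: \<rho>_def add_nonneg_pos)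
  moreover have "(1 / \<rho>) *\<^sub>R x \<in> B"
    using e C by (intro norm_ball.minkowski_less_mem[OF B x]) (simp add: \<rho>_def)
  ultimately have "minkowski B' x \<le> C * \<rho>"
    using C incl[of "(1 / \<rho>) *\<^sub>R x"] by (intro norm_ball.minkowski_le[OF B']) auto
  then show "minkowski B' x \<le> C * minkowski B x + e"
    using C by (simp add: \<rho>_def distrib_left)
qed

lemma banach_on_equivalent:
  assumes ban: "banach_on V N" and norm: "normed_on V N'" and C: "C > 0"
    and le: "\<And>x. x \<in> V \<Longrightarrow> N' x \<le> N x" and ge: "\<And>x. x \<in> V \<Longrightarrow> N x \<le> C * N' x"
  shows "banach_on V N'"
  unfolding banach_on_def
proof (intro conjI allI impI)
  have V: "subspace V" using norm by (simp add: normed_on_def)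
  fix f :: "nat \<Rightarrow> 'a"
  assume f: "range f \<subseteq> V \<and> (\<forall>e>0. \<exists>n0. \<forall>m\<ge>n0. \<forall>n\<ge>n0. N' (f m - f n) < e)"
  then have fV: "f n \<in> V" for n by auto
  have "\<exists>n0. \<forall>m\<ge>n0. \<forall>n\<ge>n0. N (f m - f n) < e" if e: "e > 0" for e
  proof -
    obtain n0 where n0: "\<And>m n. m \<ge> n0 \<Longrightarrow> n \<ge> n0 \<Longrightarrow> N' (f m - f n) < e / C"
      using f e C by (meson divide_pos_pos)
    have "N (f m - f n) < e" if "m \<ge> n0" "n \<ge> n0" for m n
    proof -
      have "N (f m - f n) \<le> C * N' (f m - f n)" by (intro ge subspace_diff V fV)
      also have "\<dots> < e" using n0[OF that] C by (simp add: field_simps)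
      finally show ?thesis .
    qed
    then show ?thesis by blast
  qed
  then obtain l where l: "l \<in> V" "(\<lambda>n. N (f n - l)) \<longlonglongrightarrow> 0"
    using ban f unfolding banach_on_def by blast
  have "(\<lambda>n. N' (f n - l)) \<longlonglongrightarrow> 0"
  proof (rule tendsto_sandwich[OF _ _ tendsto_const l(2)])
    show "\<forall>\<^sub>F n in sequentially. 0 \<le> N' (f n - l)"
      using norm fV l(1) V by (simp add: normed_on_def subspace_diff)
    show "\<forall>\<^sub>F n in sequentially. N' (f n - l) \<le> N (f n - l)"
      using le fV l(1) V by (simp add: subspace_diff)
  qed
  then show "\<exists>l\<in>V. (\<lambda>n. N' (f n - l)) \<longlonglongrightarrow> 0" using l(1) by blast
qed (rule norm)

subsection \<open>Modular balls of sequences\<close>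

text \<open>Orlicz functions without the limit condition at infinity, so that the zero function, the
  starting point of the envelopes, is included.\<close>

definition young :: "(real \<Rightarrow> real) \<Rightarrow> bool" where
  "young \<phi> \<longleftrightarrow> convex_on {0..} \<phi> \<and> mono_on {0..} \<phi> \<and> continuous_on {0..} \<phi> \<and> \<phi> 0 = 0"

lemma young_mono: "young \<phi> \<Longrightarrow> 0 \<le> s \<Longrightarrow> s \<le> t \<Longrightarrow> \<phi> s \<le> \<phi> t"
  unfolding young_def by (auto intro: mono_onD)

lemma young_nonneg: "young \<phi> \<Longrightarrow> 0 \<le> t \<Longrightarrow> 0 \<le> \<phi> t"
  using young_mono[of \<phi> 0 t] by (simp add: young_def)

lemma young_convex:
  "young \<phi> \<Longrightarrow> 0 \<le> s \<Longrightarrow> 0 \<le> t \<Longrightarrow> 0 \<le> u \<Longrightarrow> 0 \<le> v \<Longrightarrow> u + v = 1 \<Longrightarrow>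
    \<phi> (u * s + v * t) \<le> u * \<phi> s + v * \<phi> t"
  unfolding young_def convex_on_def by auto

lemma young_scale: "young \<phi> \<Longrightarrow> 0 \<le> t \<Longrightarrow> 0 \<le> u \<Longrightarrow> u \<le> 1 \<Longrightarrow> \<phi> (u * t) \<le> u * \<phi> t"
  using young_convex[of \<phi> t 0 u "1 - u"] by (simp add: young_def)

lemma young_tendsto:
  assumes "young \<phi>" "X \<longlonglongrightarrow> l" "\<And>n::nat. 0 \<le> X n"
  shows "(\<lambda>n. \<phi> (X n)) \<longlonglongrightarrow> \<phi> l"
proof (rule continuous_on_tendsto_compose[OF _ assms(2)])
  show "continuous_on {0..} \<phi>" using assms(1) by (simp add: young_def)
  show "l \<in> {0..}" using LIMSEQ_le_const[OF assms(2)] assms(3) by simp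
  show "\<forall>\<^sub>F n in sequentially. X n \<in> {0..}" using assms(3) by simp
qed

text \<open>Bounding partial sums avoids summability conditions and makes the ball closed under
  coordinatewise limits. The index \<open>i\<close> serves the levels of the polyhedral ball; the
  Orlicz ball has a single index.\<close>

definition mod_ball :: "('i \<Rightarrow> real \<Rightarrow> real) \<Rightarrow> ('i \<Rightarrow> real) \<Rightarrow> (nat \<Rightarrow> real) set" where
  "mod_ball \<phi> c = {x. \<forall>i p. (\<Sum>n<p. \<phi> i \<bar>x n\<bar>) \<le> c i}"

lemma norm_ball_mod_ball:
  assumes V: "subspace V" and young: "\<And>i. young (\<phi> i)"
    and absorbing: "\<And>x. x \<in> V \<Longrightarrow> \<exists>\<rho>>0. (1 / \<rho>) *\<^sub>R x \<in> mod_ball \<phi> c"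
    and coord: "\<And>x n. x \<in> mod_ball \<phi> c \<Longrightarrow> \<bar>x n\<bar> \<le> R"
  shows "norm_ball V (mod_ball \<phi> c)"
proof
  show "subspace V" by fact
  show "convex (mod_ball \<phi> c)"
    unfolding convex_def
  proof (intro ballI allI impI)
    fix x y and u v :: real
    assume *: "x \<in> mod_ball \<phi> c" "y \<in> mod_ball \<phi> c" "0 \<le> u" "0 \<le> v" "u + v = 1"
    have "(\<Sum>n<p. \<phi> i \<bar>(u *\<^sub>R x + v *\<^sub>R y) n\<bar>) \<le> c i" for i p
    proof -
      have "(\<Sum>n<p. \<phi> i \<bar>(u *\<^sub>R x + v *\<^sub>R y) n\<bar>) \<le> (\<Sum>n<p. u * \<phi> i \<bar>x n\<bar> + v * \<phi> i \<bar>y n\<bar>)"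
      proof (rule sum_mono)
        fix n
        have "\<bar>(u *\<^sub>R x + v *\<^sub>R y) n\<bar> \<le> u * \<bar>x n\<bar> + v * \<bar>y n\<bar>"
          using abs_triangle_ineq[of "u * x n" "v * y n"] *(3,4)
          by (simp add: scaleR_fun_def abs_mult)
        then have "\<phi> i \<bar>(u *\<^sub>R x + v *\<^sub>R y) n\<bar> \<le> \<phi> i (u * \<bar>x n\<bar> + v * \<bar>y n\<bar>)"
          by (intro young_mono[OF young]) auto
        also have "\<dots> \<le> u * \<phi> i \<bar>x n\<bar> + v * \<phi> i \<bar>y n\<bar>"
          using * by (intro young_convex[OF young]) auto
        finally show "\<phi> i \<bar>(u *\<^sub>R x + v *\<^sub>R y) n\<bar> \<le> u * \<phi> i \<bar>x n\<bar> + v * \<phi> i \<bar>y n\<bar>" .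
      qed
      also have "\<dots> = u * (\<Sum>n<p. \<phi> i \<bar>x n\<bar>) + v * (\<Sum>n<p. \<phi> i \<bar>y n\<bar>)"
        by (simp add: sum.distrib sum_distrib_left)
      also have "\<dots> \<le> u * c i + v * c i"
        using * by (intro add_mono mult_left_mono) (auto simp: mod_ball_def)
      also have "\<dots> = c i" using *(5) by (metis distrib_right mult_1)
      finally show ?thesis .
    qed
    then show "u *\<^sub>R x + v *\<^sub>R y \<in> mod_ball \<phi> c" by (simp add: mod_ball_def)
  qed
  show "- x \<in> mod_ball \<phi> c" if "x \<in> mod_ball \<phi> c" for x
    using that by (simp add: mod_ball_def)
  show "\<exists>\<rho>>0. (1 / \<rho>) *\<^sub>R x \<in> mod_ball \<phi> c" if "x \<in> V" for x by (rule absorbing[OF that])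
  show "\<exists>e>0. \<forall>\<rho>>0. (1 / \<rho>) *\<^sub>R x \<in> mod_ball \<phi> c \<longrightarrow> e \<le> \<rho>" if "x \<noteq> 0" for x
  proof -
    obtain n where n: "x n \<noteq> 0" using \<open>x \<noteq> 0\<close> by (auto simp: fun_eq_iff)
    \<comment> \<open>A nonzero coordinate bounds \<open>\<rho>\<close> from below;
      \<open>1 + \<bar>R\<bar>\<close> is a positive denominator whatever the sign of
      \<open>R\<close>.\<close>
    have "\<bar>x n\<bar> / (1 + \<bar>R\<bar>) \<le> \<rho>" if \<rho>: "\<rho> > 0" "(1 / \<rho>) *\<^sub>R x \<in> mod_ball \<phi> c" for \<rho>
    proof -
      have "\<bar>x n\<bar> / \<rho> \<le> R"
        using coord[OF \<rho>(2), of n] \<rho>(1) by (simp add: scaleR_fun_def)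
      then have "\<bar>x n\<bar> \<le> R * \<rho>" using \<rho>(1) by (simp add: field_simps)
      also have "\<dots> \<le> (1 + \<bar>R\<bar>) * \<rho>" using \<rho>(1) by (intro mult_right_mono) auto
      finally show ?thesis by (simp add: field_simps)
    qed
    then show ?thesis using n by (intro exI[of _ "\<bar>x n\<bar> / (1 + \<bar>R\<bar>)"]) auto
  qed
  show "x \<in> mod_ball \<phi> c" if x: "\<And>\<rho>. \<rho> > 1 \<Longrightarrow> (1 / \<rho>) *\<^sub>R x \<in> mod_ball \<phi> c" for x
  proof -
    have "(\<Sum>n<p. \<phi> i \<bar>x n\<bar>) \<le> c i" for i p
    proof (rule LIMSEQ_le_const2)
      \<comment> \<open>The dilations \<open>1 + 1 / (k + 1)\<close> decrease to 1, and each finite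
        sum is continuous in the coordinates.\<close>
      have "(\<lambda>k. 1 / (1 + inverse (real (Suc k)))) \<longlonglongrightarrow> 1 / (1 + 0)"
        by (intro tendsto_intros LIMSEQ_inverse_real_of_nat) auto
      then have "(\<lambda>k. 1 / (1 + inverse (real (Suc k))) * \<bar>x n\<bar>) \<longlonglongrightarrow> 1 / (1 + 0) * \<bar>x n\<bar>" for n
        by (rule tendsto_mult_right)
      then have "(\<lambda>k. 1 / (1 + inverse (real (Suc k))) * \<bar>x n\<bar>) \<longlonglongrightarrow> \<bar>x n\<bar>" for n
        by simp
      then show "(\<lambda>k. \<Sum>n<p. \<phi> i (1 / (1 + inverse (real (Suc k))) * \<bar>x n\<bar>))
          \<longlonglongrightarrow> (\<Sum>n<p. \<phi> i \<bar>x n\<bar>)"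
        by (intro tendsto_sum young_tendsto[OF young]) auto
      have "(\<Sum>n<p. \<phi> i (1 / (1 + inverse (real (Suc k))) * \<bar>x n\<bar>)) \<le> c i" for k
        using x[of "1 + inverse (real (Suc k))"]
        by (auto simp: mod_ball_def scaleR_fun_def abs_mult abs_divide)
      then show "\<exists>N. \<forall>k\<ge>N. (\<Sum>n<p. \<phi> i (1 / (1 + inverse (real (Suc k))) * \<bar>x n\<bar>)) \<le> c i"
        by blast
    qed
    then show ?thesis by (simp add: mod_ball_def)
  qed
qed

subsection \<open>The space \<open>h\<^sub>M\<close>\<close>

definition truncate :: "nat \<Rightarrow> (nat \<Rightarrow> real) \<Rightarrow> nat \<Rightarrow> real" where
  "truncate p a = (\<lambda>n. if n < p then a n else 0)"

lemma truncate_in_span: "truncate p a \<in> span (range unit_seq)"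
proof (induction p)
  case 0
  have "truncate 0 a = 0" by (auto simp: truncate_def)
  then show ?case by (simp only: span_zero)
next
  case (Suc p)
  have "truncate (Suc p) a = truncate p a + a p *\<^sub>R unit_seq p"
    by (auto simp: truncate_def unit_seq_def scaleR_fun_def fun_eq_iff less_Suc_eq)
  then show ?case using Suc by (simp only: span_add span_scale span_base rangeI)
qed

lemma span_unit_seq_eventually_zero:
  assumes "b \<in> span (range unit_seq)"
  shows "\<exists>p. \<forall>n\<ge>p. b n = 0"
  using assms
proof (induction rule: span_induct_alt)
  case base
  show ?case by auto
next
  case (step c x y)
  then obtain k p where "x = unit_seq k" "\<forall>n\<ge>p. y n = 0" by auto
  then show ?case
    by (intro exI[of _ "max p (Suc k)"]) (auto simp: unit_seq_def scaleR_fun_def)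
qed

text \<open>The description of \<open>h_M\<close> by a finite modular at every scale;
  \<open>orlicz_h_eq\<close> identifies it with the closed span of the unit vectors.\<close>

definition small_seqs :: "(real \<Rightarrow> real) \<Rightarrow> (nat \<Rightarrow> real) set" where
  "small_seqs M = {a. \<forall>C>0. summable (\<lambda>n. M (C * \<bar>a n\<bar>))}"

definition orlicz_ball :: "(real \<Rightarrow> real) \<Rightarrow> (nat \<Rightarrow> real) set" where
  "orlicz_ball M = mod_ball (\<lambda>_::unit. M) (\<lambda>_. 1)"

lemma orlicz_ball_iff: "x \<in> orlicz_ball M \<longleftrightarrow> (\<forall>p. (\<Sum>n<p. M \<bar>x n\<bar>) \<le> 1)"
  by (simp add: orlicz_ball_def mod_ball_def)

lemma small_seqsD: "a \<in> small_seqs M \<Longrightarrow> C > 0 \<Longrightarrow> summable (\<lambda>n. M (C * \<bar>a n\<bar>))"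
  by (simp add: small_seqs_def)

lemma small_seqs_abs: "a \<in> small_seqs M \<Longrightarrow> (\<lambda>n. \<bar>a n\<bar>) \<in> small_seqs M"
  by (simp add: small_seqs_def)

text \<open>For nonnegative terms, partial sums bounded by 1 amount to summability with sum at most
  1.\<close>

lemma orlicz_norm_eq_minkowski:
  assumes M: "young M"
  shows "orlicz_norm M = minkowski (orlicz_ball M)"
proof
  fix a
  have "summable (\<lambda>n. M (\<bar>a n\<bar> / \<rho>)) \<and> (\<Sum>n. M (\<bar>a n\<bar> / \<rho>)) \<le> 1
      \<longleftrightarrow> (1 / \<rho>) *\<^sub>R a \<in> orlicz_ball M" if \<rho>: "\<rho> > 0" for \<rho>
  proof -
    have nn: "0 \<le> M (\<bar>a n\<bar> / \<rho>)" for n using young_nonneg[OF M] \<rho> by simp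
    have "(1 / \<rho>) *\<^sub>R a \<in> orlicz_ball M \<longleftrightarrow> (\<forall>p. (\<Sum>n<p. M (\<bar>a n\<bar> / \<rho>)) \<le> 1)"
      using \<rho> by (simp add: orlicz_ball_iff scaleR_fun_def abs_divide)
    moreover have "(\<Sum>n<p. M (\<bar>a n\<bar> / \<rho>)) \<le> 1"
      if "summable (\<lambda>n. M (\<bar>a n\<bar> / \<rho>))" "(\<Sum>n. M (\<bar>a n\<bar> / \<rho>)) \<le> 1" for p
      using sum_le_suminf[OF that(1), of "{..<p}"] that(2) nn by simp
    moreover have "summable (\<lambda>n. M (\<bar>a n\<bar> / \<rho>))" "(\<Sum>n. M (\<bar>a n\<bar> / \<rho>)) \<le> 1"
      if *: "\<forall>p. (\<Sum>n<p. M (\<bar>a n\<bar> / \<rho>)) \<le> 1"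
    proof -
      show "summable (\<lambda>n. M (\<bar>a n\<bar> / \<rho>))"
        using * nn by (intro summableI_nonneg_bounded[of _ 1]) auto
      then show "(\<Sum>n. M (\<bar>a n\<bar> / \<rho>)) \<le> 1"
        using * by (intro suminf_le_const) auto
    qed
    ultimately show ?thesis by blast
  qed
  then have "{\<rho>. \<rho> > 0 \<and> summable (\<lambda>n. M (\<bar>a n\<bar> / \<rho>)) \<and> (\<Sum>n. M (\<bar>a n\<bar> / \<rho>)) \<le> 1}
     = {\<rho>. \<rho> > 0 \<and> (1 / \<rho>) *\<^sub>R a \<in> orlicz_ball M}"
    by blast
  then show "orlicz_norm M a = minkowski (orlicz_ball M) a"
    by (simp add: orlicz_norm_def minkowski_def)
qed

lemma orlicz_space_absorbed:
  assumes M: "young M" and a: "a \<in> orlicz_space M"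
  shows "\<exists>\<rho>>0. (1 / \<rho>) *\<^sub>R a \<in> orlicz_ball M"
proof -
  obtain \<sigma> where \<sigma>: "\<sigma> > 0" and sum: "summable (\<lambda>n. M (\<bar>a n\<bar> / \<sigma>))"
    using a by (auto simp: orlicz_space_def)
  \<comment> \<open>By convexity, dividing the argument by \<open>C \<ge> 1\<close> divides the
    modular by at least \<open>C\<close>; the maximum with 1 secures
    \<open>C \<ge> 1\<close>.\<close>
  define C where "C = max 1 (\<Sum>n. M (\<bar>a n\<bar> / \<sigma>))"
  have C: "C \<ge> 1" by (simp add: C_def)
  have "(\<Sum>n<p. M (\<bar>a n\<bar> / (\<sigma> * C))) \<le> 1" for p
  proof -
    have "M (\<bar>a n\<bar> / (\<sigma> * C)) \<le> M (\<bar>a n\<bar> / \<sigma>) / C" for n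
      using young_scale[OF M, of "\<bar>a n\<bar> / \<sigma>" "1 / C"] C \<sigma> by (simp add: mult.commute)
    then have "(\<Sum>n<p. M (\<bar>a n\<bar> / (\<sigma> * C))) \<le> (\<Sum>n<p. M (\<bar>a n\<bar> / \<sigma>)) / C"
      by (simp add: sum_divide_distrib sum_mono)
    also have "\<dots> \<le> C / C"
      using C sum_le_suminf[OF sum, of "{..<p}"] young_nonneg[OF M] \<sigma>
      by (intro divide_right_mono) (auto simp: C_def)
    finally show ?thesis using C by simp
  qed
  then show ?thesis
    using \<sigma> C by (intro exI[of _ "\<sigma> * C"]) (auto simp: orlicz_ball_iff scaleR_fun_def abs_divide)
qed

lemma small_seqs_subset: "small_seqs M \<subseteq> orlicz_space M"
proof
  fix a assume "a \<in> small_seqs M"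
  from small_seqsD[OF this, of 1] show "a \<in> orlicz_space M"
    by (auto simp: orlicz_space_def intro!: exI[of _ 1])
qed

lemma small_seqs_add:
  assumes M: "young M" and "a \<in> small_seqs M" "b \<in> small_seqs M"
  shows "a + b \<in> small_seqs M"
  unfolding small_seqs_def
proof (intro CollectI allI impI)
  fix C :: real assume C: "C > 0"
  show "summable (\<lambda>n. M (C * \<bar>(a + b) n\<bar>))"
  proof (rule summable_comparison_test')
    \<comment> \<open>The value \<open>C * (\<bar>a n\<bar> + \<bar>b n\<bar>)\<close> is the
      midpoint of the two terms at scale \<open>2 * C\<close>.\<close>
    show "summable (\<lambda>n. (1/2) * M (2 * C * \<bar>a n\<bar>) + (1/2) * M (2 * C * \<bar>b n\<bar>))"
      using assms C by (intro summable_add summable_mult small_seqsD) auto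
    fix n
    have "C * \<bar>(a + b) n\<bar> \<le> C * (\<bar>a n\<bar> + \<bar>b n\<bar>)"
      using C by (intro mult_left_mono) auto
    then have "M (C * \<bar>(a + b) n\<bar>) \<le> M ((1/2) * (2 * C * \<bar>a n\<bar>) + (1/2) * (2 * C * \<bar>b n\<bar>))"
      using C by (intro young_mono[OF M]) (auto simp: algebra_simps)
    also have "\<dots> \<le> (1/2) * M (2 * C * \<bar>a n\<bar>) + (1/2) * M (2 * C * \<bar>b n\<bar>)"
      using C by (intro young_convex[OF M]) auto
    finally show "norm (M (C * \<bar>(a + b) n\<bar>)) \<le> (1/2) * M (2 * C * \<bar>a n\<bar>) + (1/2) * M (2 * C * \<bar>b n\<bar>)"
      using young_nonneg[OF M, of "C * \<bar>(a + b) n\<bar>"] C by simp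
  qed
qed

lemma small_seqs_scale:
  assumes M: "young M" and a: "a \<in> small_seqs M"
  shows "c *\<^sub>R a \<in> small_seqs M"
proof (cases "c = 0")
  case True
  then show ?thesis using M by (simp add: small_seqs_def young_def)
next
  case False
  have "summable (\<lambda>n. M (C * \<bar>(c *\<^sub>R a) n\<bar>))" if C: "C > 0" for C
    using small_seqsD[OF a, of "C * \<bar>c\<bar>"] False C by (simp add: scaleR_fun_def abs_mult mult_ac)
  then show ?thesis by (simp add: small_seqs_def)
qed

lemma subspace_small_seqs: "young M \<Longrightarrow> subspace (small_seqs M)"
  unfolding subspace_def
  by (auto intro: small_seqs_add small_seqs_scale) (simp add: small_seqs_def young_def)

lemma summable_eventually_zero_diff:
  fixes a b :: "nat \<Rightarrow> real"
  assumes "\<forall>n\<ge>p. b n = 0"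
  shows "summable (\<lambda>n. M (C * \<bar>(a - b) n\<bar>)) \<longleftrightarrow> summable (\<lambda>n. (M (C * \<bar>a n\<bar>) :: real))"
  using assms by (intro summable_cong eventually_sequentiallyI[of p]) auto

text \<open>An approximant \<open>b\<close> within \<open>1 / C\<close> has finite support, so
  \<open>a\<close> and \<open>a - b\<close> have the same tail, and the latter has finite modular at
  scale \<open>C\<close>. Conversely, the tails of the modular of \<open>a\<close> at scale
  \<open>2 / e\<close> fall below 1, so truncations of \<open>a\<close> approximate it within
  \<open>e / 2\<close>.\<close>

lemma orlicz_h_eq:
  assumes M: "young M"
  shows "orlicz_h M = small_seqs M"
proof (intro equalityI subsetI)
  fix a assume a: "a \<in> orlicz_h M"
  show "a \<in> small_seqs M"
    unfolding small_seqs_def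
  proof (intro CollectI allI impI)
    fix C :: real assume C: "C > 0"
    then have "1 / C > 0" by simp
    then obtain b where b: "b \<in> span (range unit_seq)" "orlicz_norm M (a - b) < 1 / C"
      using a unfolding orlicz_h_def by blast
    obtain p where p: "\<forall>n\<ge>p. b n = 0"
      using span_unit_seq_eventually_zero[OF b(1)] by blast
    obtain \<sigma> where \<sigma>: "\<sigma> > 0" "summable (\<lambda>n. M ((1 / \<sigma>) * \<bar>a n\<bar>))"
      using a by (auto simp: orlicz_h_def orlicz_space_def)
    then have "summable (\<lambda>n. M ((1 / \<sigma>) * \<bar>(a - b) n\<bar>))"
      using summable_eventually_zero_diff[OF p] by blast
    then have "a - b \<in> orlicz_space M"
      using \<sigma>(1) by (auto simp: orlicz_space_def)
    \<comment> \<open>Nonemptiness is what allows a \<open>\<rho>\<close> below \<open>1 / C\<close>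
      to be extracted from the infimum.\<close>
    then have ne: "{\<rho>. \<rho> > 0 \<and> (1 / \<rho>) *\<^sub>R (a - b) \<in> orlicz_ball M} \<noteq> {}"
      using orlicz_space_absorbed[OF M] by auto
    then have "\<exists>\<rho>\<in>{\<rho>. \<rho> > 0 \<and> (1 / \<rho>) *\<^sub>R (a - b) \<in> orlicz_ball M}. \<rho> < 1 / C"
      using b(2) unfolding orlicz_norm_eq_minkowski[OF M] minkowski_def
      by (subst (asm) cInf_less_iff) (auto intro!: bdd_belowI[of _ 0])
    then obtain \<rho> where \<rho>: "\<rho> > 0" "\<rho> < 1 / C" "(1 / \<rho>) *\<^sub>R (a - b) \<in> orlicz_ball M"
      by blast
    have "summable (\<lambda>n. M (C * \<bar>(a - b) n\<bar>))"
    proof (rule summableI_nonneg_bounded)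
      show "0 \<le> M (C * \<bar>(a - b) n\<bar>)" for n using young_nonneg[OF M] C by simp
      have "M (C * \<bar>(a - b) n\<bar>) \<le> M \<bar>((1 / \<rho>) *\<^sub>R (a - b)) n\<bar>" for n
      proof (rule young_mono[OF M])
        have "C * \<bar>(a - b) n\<bar> \<le> (1 / \<rho>) * \<bar>(a - b) n\<bar>"
          using \<rho> C by (intro mult_right_mono) (auto simp: field_simps)
        then show "C * \<bar>(a - b) n\<bar> \<le> \<bar>((1 / \<rho>) *\<^sub>R (a - b)) n\<bar>"
          using \<rho>(1) by (simp add: scaleR_fun_def abs_divide)
      qed (use C in auto)
      then show "(\<Sum>n<p. M (C * \<bar>(a - b) n\<bar>)) \<le> 1" for p
        using \<rho>(3) unfolding orlicz_ball_iff by (meson order_trans sum_mono)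
    qed
    then show "summable (\<lambda>n. M (C * \<bar>a n\<bar>))"
      using summable_eventually_zero_diff[OF p] by blast
  qed
next
  fix a assume a: "a \<in> small_seqs M"
  have "\<exists>b \<in> span (range unit_seq). orlicz_norm M (a - b) < e" if e: "e > 0" for e
  proof -
    have sum: "summable (\<lambda>n. M (\<bar>a n\<bar> / (e / 2)))"
      using small_seqsD[OF a, of "2 / e"] e by (simp add: field_simps)
    have nn: "0 \<le> M (\<bar>a n\<bar> / (e / 2))" for n using young_nonneg[OF M] e by simp
    obtain p where p: "\<And>m n. m \<ge> p \<Longrightarrow> \<bar>\<Sum>n = m..<n. M (\<bar>a n\<bar> / (e / 2))\<bar> < 1"
      using sum unfolding summable_Cauchy by (metis real_norm_def zero_less_one)
    have "(1 / (e / 2)) *\<^sub>R (a - truncate p a) \<in> orlicz_ball M"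
      unfolding orlicz_ball_iff
    proof
      fix q
      have "(\<Sum>n<q. M \<bar>((1 / (e / 2)) *\<^sub>R (a - truncate p a)) n\<bar>)
          = (\<Sum>n<q. if p \<le> n then M (\<bar>a n\<bar> / (e / 2)) else 0)"
        using M e by (intro sum.cong)
          (auto simp: truncate_def scaleR_fun_def young_def abs_mult mult.commute)
      also have "\<dots> = (\<Sum>n = p..<q. M (\<bar>a n\<bar> / (e / 2)))"
        by (simp add: sum.If_cases) (intro sum.cong, auto)
      also have "\<dots> \<le> 1" using p[of p q] by auto
      finally show "(\<Sum>n<q. M \<bar>((1 / (e / 2)) *\<^sub>R (a - truncate p a)) n\<bar>) \<le> 1" .
    qed
    then have "minkowski (orlicz_ball M) (a - truncate p a) \<le> e / 2"
      unfolding minkowski_def using e by (intro cInf_lower bdd_belowI[of _ 0]) auto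
    then show ?thesis
      using e truncate_in_span by (intro bexI[of _ "truncate p a"])
        (auto simp: orlicz_norm_eq_minkowski[OF M])
  qed
  then show "a \<in> orlicz_h M" using a small_seqs_subset by (auto simp: orlicz_h_def)
qed

section \<open>Completeness of \<open>h_M\<close>\<close>

lemma orlicz_ball_coord:
  assumes M: "young M" and R: "R > 0" "M R > 1" and x: "x \<in> orlicz_ball M"
  shows "\<bar>x n\<bar> \<le> R"
proof (rule ccontr)
  assume "\<not> ?thesis"
  then have "M R \<le> M \<bar>x n\<bar>" using R by (intro young_mono[OF M]) auto
  also have "\<dots> \<le> (\<Sum>i<Suc n. M \<bar>x i\<bar>)"
    by (intro member_le_sum) (auto intro: young_nonneg[OF M])
  also have "\<dots> \<le> 1" using x unfolding orlicz_ball_iff by blast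
  finally show False using R by simp
qed

lemma norm_ball_orlicz_ball:
  assumes M: "young M" and R: "R > 0" "M R > 1"
  shows "norm_ball (small_seqs M) (orlicz_ball M)"
  unfolding orlicz_ball_def
proof (rule norm_ball_mod_ball)
  show "\<exists>\<rho>>0. (1 / \<rho>) *\<^sub>R x \<in> mod_ball (\<lambda>_::unit. M) (\<lambda>_. 1)" if "x \<in> small_seqs M" for x
    using orlicz_space_absorbed[OF M] small_seqs_subset that by (auto simp: orlicz_ball_def)
  show "\<bar>x n\<bar> \<le> R" if "x \<in> mod_ball (\<lambda>_::unit. M) (\<lambda>_. 1)" for x n
    using orlicz_ball_coord[OF M R] that by (auto simp: orlicz_ball_def)
qed (use M subspace_small_seqs in auto)

text \<open>Cauchy sequences converge in each coordinate, and since the ball is defined by finite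
  sums, its inequalities survive the coordinatewise limit. This yields convergence in norm as well
  as membership of the limit.\<close>

lemma banach_on_orlicz:
  assumes M: "young M" and R: "R > 0" "M R > 1"
  shows "banach_on (small_seqs M) (minkowski (orlicz_ball M))"
  unfolding banach_on_def
proof (intro conjI allI impI)
  interpret norm_ball "small_seqs M" "orlicz_ball M" by (rule norm_ball_orlicz_ball[OF assms])
  let ?N = "minkowski (orlicz_ball M)"
  show "normed_on (small_seqs M) ?N" by (rule normed_on_minkowski)
  fix f :: "nat \<Rightarrow> nat \<Rightarrow> real"
  assume *: "range f \<subseteq> small_seqs M \<and> (\<forall>e>0. \<exists>n0. \<forall>m\<ge>n0. \<forall>n\<ge>n0. ?N (f m - f n) < e)"
  then have f: "f n \<in> small_seqs M" for n by auto
  have cauchy: "\<exists>n0. \<forall>m\<ge>n0. \<forall>n\<ge>n0. (1 / e) *\<^sub>R (f m - f n) \<in> orlicz_ball M" if "e > 0" for e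
    using * that minkowski_less_mem[OF subspace_diff[OF V f f]] by meson
  have "Cauchy (\<lambda>m. f m i)" for i
  proof (rule CauchyI)
    fix e :: real assume e: "e > 0"
    \<comment> \<open>Coordinates in the ball are at most \<open>R\<close>, so this scale bounds the
      coordinate differences by \<open>e / 2\<close>.\<close>
    obtain n0 where n0: "\<And>m n. m \<ge> n0 \<Longrightarrow> n \<ge> n0 \<Longrightarrow> (1 / (e / (2 * R))) *\<^sub>R (f m - f n) \<in> orlicz_ball M"
      using cauchy[of "e / (2 * R)"] e R by auto
    have "norm (f m i - f n i) < e" if "m \<ge> n0" "n \<ge> n0" for m n
    proof -
      have "2 * R * \<bar>f m i - f n i\<bar> / e \<le> R"
        using orlicz_ball_coord[OF M R n0[OF that], of i] e R
        by (simp add: scaleR_fun_def abs_mult abs_divide)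
      then have "R * (2 * \<bar>f m i - f n i\<bar>) \<le> R * e" using e by (simp add: field_simps)
      then have "\<bar>f m i - f n i\<bar> \<le> e / 2" using R by simp
      also have "\<dots> < e" using e by simp
      finally show ?thesis by simp
    qed
    then show "\<exists>n0. \<forall>m\<ge>n0. \<forall>n\<ge>n0. norm (f m i - f n i) < e" by blast
  qed
  then have "\<exists>l. (\<lambda>m. f m i) \<longlonglongrightarrow> l" for i
    by (simp add: real_Cauchy_convergent convergentD)
  then obtain l where l: "\<And>i. (\<lambda>m. f m i) \<longlonglongrightarrow> l i" by metis
  have lim: "\<exists>n0. \<forall>n\<ge>n0. (1 / e) *\<^sub>R (f n - l) \<in> orlicz_ball M" if e: "e > 0" for e
  proof -
    obtain n0 where n0: "\<And>m n. m \<ge> n0 \<Longrightarrow> n \<ge> n0 \<Longrightarrow> (1 / e) *\<^sub>R (f n - f m) \<in> orlicz_ball M"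
      using cauchy[OF e] by blast
    have "(\<Sum>i<p. M \<bar>((1 / e) *\<^sub>R (f n - l)) i\<bar>) \<le> 1" if n: "n \<ge> n0" for n p
    proof (rule LIMSEQ_le_const2)
      have "(\<lambda>m. \<bar>((1 / e) *\<^sub>R (f n - f m)) i\<bar>) \<longlonglongrightarrow> \<bar>((1 / e) *\<^sub>R (f n - l)) i\<bar>" for i
        by (simp add: scaleR_fun_def) (intro tendsto_intros l, use e in auto)
      then show "(\<lambda>m. \<Sum>i<p. M \<bar>((1 / e) *\<^sub>R (f n - f m)) i\<bar>) \<longlonglongrightarrow> (\<Sum>i<p. M \<bar>((1 / e) *\<^sub>R (f n - l)) i\<bar>)"
        by (intro tendsto_sum young_tendsto[OF M]) auto
      show "\<exists>k. \<forall>m\<ge>k. (\<Sum>i<p. M \<bar>((1 / e) *\<^sub>R (f n - f m)) i\<bar>) \<le> 1"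
        using n0 n unfolding orlicz_ball_iff by blast
    qed
    then show ?thesis unfolding orlicz_ball_iff by blast
  qed
  have lH: "l \<in> small_seqs M"
    unfolding small_seqs_def
  proof (intro CollectI allI impI)
    fix C :: real assume C: "C > 0"
    \<comment> \<open>Scale \<open>2 * C\<close> leaves room for convexity: \<open>l\<close> is
      compared with the sum of \<open>f n - l\<close> and \<open>f n\<close>, each weighted by one
      half.\<close>
    obtain n where n: "(1 / (1 / (2 * C))) *\<^sub>R (f n - l) \<in> orlicz_ball M"
      using lim[of "1 / (2 * C)"] C by auto
    have d: "summable (\<lambda>i. M (2 * C * \<bar>(f n - l) i\<bar>))"
    proof (rule summableI_nonneg_bounded)
      show "0 \<le> M (2 * C * \<bar>(f n - l) i\<bar>)" for i using young_nonneg[OF M] C by simp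
      show "(\<Sum>i<p. M (2 * C * \<bar>(f n - l) i\<bar>)) \<le> 1" for p
        using n C by (simp add: orlicz_ball_iff scaleR_fun_def abs_mult)
    qed
    show "summable (\<lambda>i. M (C * \<bar>l i\<bar>))"
    proof (rule summable_comparison_test')
      show "summable (\<lambda>i. (1/2) * M (2 * C * \<bar>(f n - l) i\<bar>) + (1/2) * M (2 * C * \<bar>f n i\<bar>))"
        by (intro summable_add summable_mult d small_seqsD[OF f]) (use C in auto)
      fix i
      have "C * \<bar>l i\<bar> \<le> C * (\<bar>(f n - l) i\<bar> + \<bar>f n i\<bar>)"
        using C by (intro mult_left_mono) auto
      then have "M (C * \<bar>l i\<bar>) \<le> M ((1/2) * (2 * C * \<bar>(f n - l) i\<bar>) + (1/2) * (2 * C * \<bar>f n i\<bar>))"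
        using C by (intro young_mono[OF M]) (auto simp: algebra_simps)
      also have "\<dots> \<le> (1/2) * M (2 * C * \<bar>(f n - l) i\<bar>) + (1/2) * M (2 * C * \<bar>f n i\<bar>)"
        using C by (intro young_convex[OF M]) auto
      finally show "norm (M (C * \<bar>l i\<bar>)) \<le> (1/2) * M (2 * C * \<bar>(f n - l) i\<bar>) + (1/2) * M (2 * C * \<bar>f n i\<bar>)"
        using young_nonneg[OF M, of "C * \<bar>l i\<bar>"] C by simp
    qed
  qed
  have "(\<lambda>n. ?N (f n - l)) \<longlonglongrightarrow> 0"
  proof (rule LIMSEQ_I)
    fix e :: real assume e: "e > 0"
    obtain n0 where n0: "\<And>n. n \<ge> n0 \<Longrightarrow> (1 / (e / 2)) *\<^sub>R (f n - l) \<in> orlicz_ball M"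
      using lim[of "e / 2"] e by auto
    have "norm (?N (f n - l) - 0) < e" if "n \<ge> n0" for n
      using minkowski_le[OF _ n0[OF that]] minkowski_nonneg[OF subspace_diff[OF V f lH], of n] e
      by simp
    then show "\<exists>n0. \<forall>n\<ge>n0. norm (?N (f n - l) - 0) < e" by blast
  qed
  then show "\<exists>l\<in>small_seqs M. (\<lambda>n. ?N (f n - l)) \<longlonglongrightarrow> 0" using lH by blast
qed

subsection \<open>Piecewise linear minorants\<close>

text \<open>The chord of \<open>M\<close> from the origin to \<open>(s, M s)\<close>, lowered by
  \<open>M s\<close> so that it vanishes at \<open>s\<close>. It takes the value \<open>M s\<close>
  at \<open>2 * s\<close>.\<close>

definition secant :: "(real \<Rightarrow> real) \<Rightarrow> real \<Rightarrow> real \<Rightarrow> real" where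
  "secant M s t = M s / s * (t - s)"

text \<open>Stage \<open>j\<close> uses the nodes \<open>(1 / K) ^ i\<close> with
  \<open>i < j\<close>; starting from 0 builds in the positive part.\<close>

primrec envelope :: "(real \<Rightarrow> real) \<Rightarrow> real \<Rightarrow> nat \<Rightarrow> real \<Rightarrow> real" where
  "envelope M K 0 t = 0"
| "envelope M K (Suc j) t = max (envelope M K j t) (secant M ((1 / K) ^ j) t)"

lemma secant_nonpos: "young M \<Longrightarrow> 0 < s \<Longrightarrow> t \<le> s \<Longrightarrow> secant M s t \<le> 0"
  using young_nonneg[of M s] by (simp add: secant_def mult_nonneg_nonpos divide_nonpos_pos)

text \<open>Monotonicity of \<open>M t / t\<close>, free of division.\<close>

lemma young_slope:
  assumes "young M" "0 < s" "s \<le> t"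
  shows "t * M s \<le> s * M t"
  using young_scale[OF assms(1), of t "s / t"] assms by (simp add: field_simps)

text \<open>Beyond \<open>s\<close> one has \<open>q * M s * (t - s) \<le> M (K * s) * t\<close>,
  and \<open>M t / t\<close> is nondecreasing. The case \<open>q = K = 1\<close> puts secants below
  \<open>M\<close>; large \<open>q\<close> makes late secants negligible against the dilated
  function.\<close>

lemma secant_bound:
  assumes M: "young M" and s: "0 < s" and t: "0 \<le> t" and K: "K \<ge> 1" and q: "q > 0"
    and le: "q * M s \<le> M (K * s)"
  shows "q * secant M s t \<le> M (K * t)"
proof (cases "t \<le> s")
  case True
  then have "q * secant M s t \<le> 0"
    using secant_nonpos[OF M s] q by (simp add: mult_nonneg_nonpos)
  also have "0 \<le> M (K * t)" using young_nonneg[OF M] t K by simp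
  finally show ?thesis .
next
  case False
  have "s * (q * secant M s t) = q * M s * (t - s)" using s by (simp add: secant_def)
  also have "\<dots> \<le> M (K * s) * t"
    using le False s q K by (intro mult_mono) (auto intro: young_nonneg[OF M])
  also have "\<dots> \<le> s * M (K * t)"
    using young_slope[OF M, of "K * s" "K * t"] False s K by (simp add: algebra_simps)
  finally show ?thesis using s by simp
qed

lemma envelope_le:
  assumes "young M" "K > 0" "0 \<le> t"
  shows "envelope M K j t \<le> M t"
proof (induction j)
  case 0
  show ?case using young_nonneg assms by simp
next
  case (Suc j)
  then show ?case using secant_bound[of M "(1 / K) ^ j" t 1 1] assms by simp
qed

lemma envelope_mono_index: "i \<le> j \<Longrightarrow> envelope M K i t \<le> envelope M K j t"
  by (rule lift_Suc_mono_le[of "\<lambda>j. envelope M K j t"]) auto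

lemma young_max:
  assumes \<phi>: "young \<phi>" and M: "young M" and s: "0 < s"
  shows "young (\<lambda>t. max (\<phi> t) (secant M s t))"
  unfolding young_def
proof (intro conjI)
  have slope: "M s / s \<ge> 0" using young_nonneg[OF M] s by simp
  show "convex_on {0..} (\<lambda>t. max (\<phi> t) (secant M s t))"
  proof (rule convex_onI)
    fix u x y :: real assume *: "0 < u" "u < 1" "x \<in> {0..}" "y \<in> {0..}"
    have "\<phi> ((1 - u) * x + u * y) \<le> (1 - u) * \<phi> x + u * \<phi> y"
      using * by (intro young_convex[OF \<phi>]) auto
    moreover have "secant M s ((1 - u) * x + u * y) = (1 - u) * secant M s x + u * secant M s y"
      unfolding secant_def by algebra
    moreover have "(1 - u) * \<phi> x + u * \<phi> y
        \<le> (1 - u) * max (\<phi> x) (secant M s x) + u * max (\<phi> y) (secant M s y)"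
      using * by (intro add_mono mult_left_mono) auto
    moreover have "(1 - u) * secant M s x + u * secant M s y
        \<le> (1 - u) * max (\<phi> x) (secant M s x) + u * max (\<phi> y) (secant M s y)"
      using * by (intro add_mono mult_left_mono) auto
    ultimately show "max (\<phi> ((1 - u) *\<^sub>R x + u *\<^sub>R y)) (secant M s ((1 - u) *\<^sub>R x + u *\<^sub>R y))
        \<le> (1 - u) * max (\<phi> x) (secant M s x) + u * max (\<phi> y) (secant M s y)"
      by simp
  qed (rule convex_real_interval)
  show "mono_on {0..} (\<lambda>t. max (\<phi> t) (secant M s t))"
  proof (rule mono_onI)
    fix x y :: real assume *: "x \<in> {0..}" "y \<in> {0..}" "x \<le> y"
    have "secant M s x \<le> secant M s y"
      unfolding secant_def using slope * by (intro mult_left_mono) auto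
    then show "max (\<phi> x) (secant M s x) \<le> max (\<phi> y) (secant M s y)"
      using young_mono[OF \<phi>, of x y] * by (intro max.mono) auto
  qed
  show "continuous_on {0..} (\<lambda>t. max (\<phi> t) (secant M s t))"
    using \<phi> unfolding secant_def young_def by (intro continuous_intros) auto
  show "max (\<phi> 0) (secant M s 0) = 0"
    using \<phi> secant_nonpos[OF M s, of 0] s by (simp add: young_def)
qed

lemma young_envelope:
  assumes "young M" "K > 0"
  shows "young (envelope M K j)"
proof (induction j)
  case 0
  show ?case
    by (auto simp: young_def convex_on_def mono_on_def)
next
  case (Suc j)
  then show ?case using young_max[OF Suc assms(1), of "(1 / K) ^ j"] assms(2) by simp
qed

text \<open>Each secant from stage \<open>J\<close> on is at most \<open>M (K * t) / q\<close>. As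
  the envelope is a maximum, these bounds do not accumulate, so the bound on the gain does not
  depend on \<open>i\<close>.\<close>

lemma envelope_increment:
  assumes M: "young M" and K: "K \<ge> 1" and q: "q > 0" and t: "0 \<le> t"
    and J: "\<And>j. j \<ge> J \<Longrightarrow> q * M ((1 / K) ^ j) \<le> M (K * (1 / K) ^ j)"
  shows "envelope M K i t \<le> envelope M K J t + M (K * t) / q"
proof (cases "i \<le> J")
  case True
  then show ?thesis
    using envelope_mono_index[OF True, of M K t] young_nonneg[OF M, of "K * t"] K q t
    by (simp add: add_increasing2)
next
  case False
  then have "J \<le> i" by simp
  then show ?thesis
  proof (induction i rule: dec_induct)
    case base
    show ?case using young_nonneg[OF M, of "K * t"] K q t by simp
  next
    case (step i)
    have "q * secant M ((1 / K) ^ i) t \<le> M (K * t)"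
      using J[OF step(1)] by (intro secant_bound[OF M _ t K q]) (use K in auto)
    then have "secant M ((1 / K) ^ i) t \<le> M (K * t) / q"
      using q by (simp add: field_simps)
    moreover have "0 \<le> envelope M K J t"
      using young_nonneg[OF young_envelope[OF M]] K t by simp
    ultimately show ?case using step by simp
  qed
qed

text \<open>A stage has finitely many nodes, all positive. Along a null sequence it therefore sees
  only finitely many coordinates.\<close>

lemma envelope_eq_0_near_0:
  assumes "young M" "K > 0"
  shows "\<exists>\<delta>>0. \<forall>t. 0 \<le> t \<and> t \<le> \<delta> \<longrightarrow> envelope M K j t = 0"
proof (induction j)
  case 0
  show ?case by (auto intro: exI[of _ 1])
next
  case (Suc j)
  then obtain \<delta> where "\<delta> > 0" "\<forall>t. 0 \<le> t \<and> t \<le> \<delta> \<longrightarrow> envelope M K j t = 0" by blast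
  then show ?case
    using assms secant_nonpos[OF assms(1), of "(1 / K) ^ j"]
    by (intro exI[of _ "min \<delta> ((1 / K) ^ j)"]) (auto simp: max_def intro: antisym)
qed

text \<open>If a node \<open>s\<close> satisfies \<open>t / K\<^sup>2 \<le> s\<close> and
  \<open>K * s < t\<close>, then \<open>K \<ge> 2\<close> gives \<open>t - s \<ge> s\<close>, and
  the secant at \<open>s\<close> is at least \<open>M s \<ge> M (t / C)\<close>. Consecutive nodes
  differ by the factor \<open>K\<close>, so the window contains one.\<close>

lemma envelope_ge:
  assumes M: "young M" and K: "K \<ge> 2" and C: "C \<ge> K\<^sup>2" and t: "0 \<le> t" "t \<le> C"
  shows "\<exists>j. M (t / C) \<le> envelope M K j t"
proof -
  consider "t = 0" | "t > K\<^sup>2" | "0 < t" "t \<le> K\<^sup>2" using t by linarith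
  then show ?thesis
  proof cases
    case 1
    then show ?thesis using M by (auto simp: young_def intro: exI[of _ 0])
  next
    case 2
    have "2\<^sup>2 \<le> K\<^sup>2" using K by (intro power_mono) auto
    then have t2: "t \<ge> 2" using 2 by simp
    \<comment> \<open>All nodes are at most 1, hence below the window; here node 1 suffices because
      \<open>t \<le> C\<close>.\<close>
    have "M (t / C) \<le> M 1" using t t2 by (intro young_mono[OF M]) auto
    also have "\<dots> \<le> M 1 * (t - 1)"
      using mult_left_mono[of 1 "t - 1" "M 1"] young_nonneg[OF M, of 1] t2 by simp
    also have "\<dots> \<le> envelope M K (Suc 0) t" by (simp add: secant_def)
    finally show ?thesis by blast
  next
    case 3
    have "0 < t / K\<^sup>2" "1 / K < 1" using 3 K by auto
    then have ex: "\<exists>j. (1 / K) ^ Suc j < t / K\<^sup>2"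
    proof -
      obtain j where "(1 / K) ^ j < t / K\<^sup>2"
        using real_arch_pow_inv[of "t / K\<^sup>2" "1 / K"] \<open>0 < t / K\<^sup>2\<close> \<open>1 / K < 1\<close> by blast
      moreover have "(1 / K) ^ Suc j \<le> (1 / K) ^ j"
        using K by (intro power_decreasing) auto
      ultimately show ?thesis by (intro exI[of _ j]) linarith
    qed
    \<comment> \<open>The last node not below \<open>t / K\<^sup>2\<close>: minimality gives
      \<open>t / K\<^sup>2 \<le> s\<close>, and the smallness of the next node gives
      \<open>K * s < t\<close>.\<close>
    define j where "j = (LEAST j. (1 / K) ^ Suc j < t / K\<^sup>2)"
    define s where "s = (1 / K) ^ j"
    have s0: "s > 0" using K by (simp add: s_def)
    have "(1 / K) ^ Suc j < t / K\<^sup>2" unfolding j_def by (rule LeastI_ex[OF ex])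
    then have "K * s < t" using K by (simp add: s_def field_simps power2_eq_square)
    moreover have "2 * s \<le> K * s" using K s0 by (intro mult_right_mono) auto
    ultimately have ts: "s \<le> t - s" by linarith
    have "t / K\<^sup>2 \<le> s"
    proof (cases j)
      case 0
      then show ?thesis using 3 K by (simp add: s_def)
    next
      case (Suc i)
      then have "\<not> (1 / K) ^ Suc i < t / K\<^sup>2"
        using not_less_Least[of i "\<lambda>j. (1 / K) ^ Suc j < t / K\<^sup>2"] by (simp add: j_def)
      then show ?thesis by (simp add: s_def Suc)
    qed
    moreover have "t / C \<le> t / K\<^sup>2" using C K 3 by (intro divide_left_mono) auto
    ultimately have "M (t / C) \<le> M s"
      using t by (intro young_mono[OF M]) auto
    also have "\<dots> = M s / s * s" using s0 by simp
    also have "\<dots> \<le> secant M s t"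
      unfolding secant_def using ts s0 young_nonneg[OF M, of s] by (intro mult_left_mono) auto
    also have "\<dots> \<le> envelope M K (Suc j) t" by (simp add: s_def)
    finally show ?thesis by blast
  qed
qed

lemma max_affine_envelope:
  assumes M: "young M" and K: "K > 0"
  shows "max_affine (\<lambda>x::nat \<Rightarrow> real. envelope M K j \<bar>x n\<bar>)"
proof (induction j)
  case 0
  show ?case by (simp add: max_affine_const)
next
  case (Suc j)
  define s where "s = (1 / K) ^ j"
  have slope: "M s / s \<ge> 0" using young_nonneg[OF M, of s] K by (simp add: s_def)
  have lin: "linear (\<lambda>x::nat \<Rightarrow> real. c * x n)" for c
    by (rule linearI) (auto simp: scaleR_fun_def algebra_simps)
  \<comment> \<open>A nonnegative slope turns the absolute value into a maximum of two affine
    functionals.\<close>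
  have "secant M s \<bar>x n\<bar> = max (M s / s * x n + - (M s / s * s)) (- (M s / s) * x n + - (M s / s * s))"
    for x :: "nat \<Rightarrow> real"
  proof -
    have "M s / s * \<bar>x n\<bar> = \<bar>M s / s * x n\<bar>"
      using slope by (simp only: abs_mult abs_of_nonneg)
    then show ?thesis unfolding secant_def right_diff_distrib by linarith
  qed
  then have "max_affine (\<lambda>x::nat \<Rightarrow> real. secant M s \<bar>x n\<bar>)"
    by (simp only:) (intro max_affine_max max_affine_affine lin)
  then show ?case using max_affine_max[OF Suc] by (simp add: s_def)
qed

subsection \<open>Domination on finite dimensional subspaces\<close>

text \<open>Gaussian elimination: after subtracting multiples of \<open>b\<close>, the other generators
  vanish at a coordinate \<open>m\<close> with \<open>b m \<noteq> 0\<close>.\<close>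

lemma span_dominated:
  fixes W B :: "(nat \<Rightarrow> real) set"
  assumes W: "subspace W" and abs: "\<And>a. a \<in> W \<Longrightarrow> (\<lambda>n. \<bar>a n\<bar>) \<in> W"
    and B: "finite B" "B \<subseteq> W"
  shows "\<exists>T u. finite T \<and> u \<in> W \<and> (\<forall>n. 0 \<le> u n) \<and>
    (\<forall>x\<in>span B. \<forall>n. \<bar>x n\<bar> \<le> (\<Sum>m\<in>T. \<bar>x m\<bar>) * u n)"
  using B
proof (induction "card B" arbitrary: B rule: less_induct)
  case less
  show ?case
  proof (cases "B \<subseteq> {0}")
    case True
    then have "span B \<subseteq> {0}" by (metis span_mono span_empty span_insert_0)
    then show ?thesis using subspace_0[OF W] by (intro exI[of _ "{}"] exI[of _ 0]) auto
  next
    case False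
    then obtain b m where b: "b \<in> B" "b m \<noteq> 0" by (auto simp: fun_eq_iff subset_iff)
    define B' where "B' = B - {b}"
    have BB: "B = insert b B'" using b by (auto simp: B'_def)
    have bW: "b \<in> W" using b less.prems by auto
    define g where "g x = x - (x m / b m) *\<^sub>R b" for x :: "nat \<Rightarrow> real"
    have lin: "linear g"
      by (rule linearI)
        (auto simp: g_def scaleR_fun_def fun_eq_iff add_divide_distrib algebra_simps)
    have gW: "g ` B' \<subseteq> W"
      using less.prems W bW by (auto simp: g_def B'_def subspace_diff subspace_scale)
    have "card (g ` B') < card B"
      using less.prems b card_image_le[of B' g] card_Diff1_less[of B b]
      unfolding B'_def by (meson finite_Diff le_less_trans)
    then obtain T u where T: "finite T" and u: "u \<in> W" "\<And>n. 0 \<le> u n"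
      and dom: "\<And>x n. x \<in> span (g ` B') \<Longrightarrow> \<bar>x n\<bar> \<le> (\<Sum>m\<in>T. \<bar>x m\<bar>) * u n"
      using less.hyps[of "g ` B'"] less.prems gW by (auto simp: B'_def)
    define A where "A = (\<Sum>j\<in>T. \<bar>b j / b m\<bar>)"
    have A0: "A \<ge> 0" by (simp add: A_def sum_nonneg)
    \<comment> \<open>The factor \<open>1 + A\<close> pays for the growth of the coordinates in
      \<open>T\<close> under \<open>g\<close>; the second summand dominates the multiple of
      \<open>b\<close> that \<open>g\<close> removes.\<close>
    define u' where "u' = (1 + A) *\<^sub>R u + (1 / \<bar>b m\<bar>) *\<^sub>R (\<lambda>n. \<bar>b n\<bar>)"
    have u'W: "u' \<in> W"
      unfolding u'_def by (intro subspace_add subspace_scale W u abs bW)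
    have u': "u' n = (1 + A) * u n + \<bar>b n\<bar> / \<bar>b m\<bar>" for n
      by (simp add: u'_def scaleR_fun_def)
    have "\<bar>x n\<bar> \<le> (\<Sum>m\<in>insert m T. \<bar>x m\<bar>) * u' n" if x: "x \<in> span B" for x n
    proof -
      let ?s = "\<Sum>m\<in>insert m T. \<bar>x m\<bar>"
      obtain k where k: "x - k *\<^sub>R b \<in> span B'" using x span_breakdown_eq BB by blast
      have "g b = 0" using b by (simp add: g_def)
      \<comment> \<open>Since \<open>g\<close> kills \<open>b\<close>, only the component of
        \<open>x\<close> in the span of \<open>B'\<close> matters.\<close>
      then have "g x = g (x - k *\<^sub>R b)"
        using lin by (simp only: linear_diff linear_scale scaleR_zero_right diff_zero)
      then have gx: "g x \<in> span (g ` B')"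
        using k linear_span_image[OF lin, of B'] by auto
      have xm: "\<bar>x m\<bar> \<le> ?s" and xT: "(\<Sum>m\<in>T. \<bar>x m\<bar>) \<le> ?s"
        using T by (auto intro!: member_le_sum sum_mono2)
      have gj: "\<bar>g x j\<bar> \<le> \<bar>x j\<bar> + \<bar>x m\<bar> * \<bar>b j / b m\<bar>" for j
        using abs_triangle_ineq4[of "x j" "x m / b m * b j"]
        by (simp add: g_def scaleR_fun_def abs_mult abs_divide)
      have "(\<Sum>j\<in>T. \<bar>g x j\<bar>) \<le> (\<Sum>j\<in>T. \<bar>x j\<bar>) + \<bar>x m\<bar> * A"
        unfolding A_def sum_distrib_left sum.distrib[symmetric] by (intro sum_mono gj)
      also have "\<dots> \<le> ?s + ?s * A"
        using xm xT A0 by (intro add_mono mult_right_mono)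
      also have "\<dots> = ?s * (1 + A)" by (simp add: distrib_left)
      finally have "(\<Sum>j\<in>T. \<bar>g x j\<bar>) * u n \<le> ?s * (1 + A) * u n"
        using u(2) by (intro mult_right_mono)
      then have "\<bar>g x n\<bar> \<le> ?s * (1 + A) * u n" using dom[OF gx, of n] by linarith
      moreover have "\<bar>x n\<bar> \<le> \<bar>g x n\<bar> + \<bar>x m\<bar> * (\<bar>b n\<bar> / \<bar>b m\<bar>)"
        using abs_triangle_ineq[of "g x n" "x m / b m * b n"]
        by (simp add: g_def scaleR_fun_def abs_mult abs_divide)
      moreover have "\<bar>x m\<bar> * (\<bar>b n\<bar> / \<bar>b m\<bar>) \<le> ?s * (\<bar>b n\<bar> / \<bar>b m\<bar>)"
        using xm by (intro mult_right_mono) auto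
      ultimately have "\<bar>x n\<bar> \<le> ?s * (1 + A) * u n + ?s * (\<bar>b n\<bar> / \<bar>b m\<bar>)" by linarith
      also have "\<dots> = ?s * u' n" unfolding u' by (simp add: algebra_simps)
      finally show ?thesis .
    qed
    moreover have "0 \<le> u' n" for n using u(2) A0 by (simp add: u')
    ultimately show ?thesis using T u'W by (intro exI[of _ "insert m T"] exI[of _ u']) auto
  qed
qed


subsection \<open>The polyhedral norm\<close>

text \<open>The thresholds \<open>2 - (1/2) ^ k\<close> leave room for the gain of passing from level \<open>k\<close> to
  level \<open>k + 1\<close>; on a dominated set this gain is at most a constant times
  \<open>(1/4) ^ k\<close>, so only finitely many levels matter there.\<close>

definition poly_ball :: "(real \<Rightarrow> real) \<Rightarrow> real \<Rightarrow> (nat \<Rightarrow> nat) \<Rightarrow> (nat \<Rightarrow> real) set" where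
  "poly_ball M K J = mod_ball (\<lambda>k. envelope M K (J k)) (\<lambda>k. 2 - (1 / 2) ^ k)"

lemma poly_ball_iff:
  "x \<in> poly_ball M K J \<longleftrightarrow> (\<forall>k p. (\<Sum>n<p. envelope M K (J k) \<bar>x n\<bar>) \<le> 2 - (1 / 2) ^ k)"
  by (simp add: poly_ball_def mod_ball_def)

text \<open>The growth condition, sampled at the nodes with factor \<open>4 ^ k\<close> from stage
  \<open>J k\<close> on. The condition \<open>J_ge\<close> makes the levels exhaust all
  secants.\<close>

locale fast_orlicz =
  fixes M :: "real \<Rightarrow> real" and K :: real and J :: "nat \<Rightarrow> nat"
  assumes M: "young M" and M1: "M 1 > 0" and unbounded: "\<exists>R>0. M R > 1"
    and K: "K \<ge> 2" and J_ge: "\<And>k. k \<le> J k"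
    and growth: "\<And>k j. J k \<le> j \<Longrightarrow> 4 ^ k * M ((1 / K) ^ j) \<le> M (K * (1 / K) ^ j)"
begin

text \<open>The first entry is the dilation required by \<open>envelope_ge\<close>, the second
  bounds the coordinates in the polyhedral ball.\<close>

abbreviation "C \<equiv> max (K\<^sup>2) (1 + 2 / M 1)"

lemma young_env: "young (envelope M K j)"
  using young_envelope[OF M] K by simp

lemma env_nonneg: "0 \<le> envelope M K j \<bar>t\<bar>"
  by (rule young_nonneg[OF young_env]) simp

lemma C_pos: "C > 0" using K by (simp add: less_max_iff_disj)

section \<open>Equivalence of the Orlicz ball and the polyhedral ball\<close>

lemma orlicz_ball_subset: "orlicz_ball M \<subseteq> poly_ball M K J"
proof
  fix x assume x: "x \<in> orlicz_ball M"
  have "(\<Sum>n<p. envelope M K (J k) \<bar>x n\<bar>) \<le> 2 - (1 / 2) ^ k" for k p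
  proof -
    have "(\<Sum>n<p. envelope M K (J k) \<bar>x n\<bar>) \<le> (\<Sum>n<p. M \<bar>x n\<bar>)"
      using K by (intro sum_mono envelope_le[OF M]) auto
    also have "\<dots> \<le> 1" using x by (simp add: orlicz_ball_iff)
    also have "(1::real) \<le> 2 - (1 / 2) ^ k" using power_le_one[of "1 / 2 :: real" k] by simp
    finally show ?thesis .
  qed
  then show "x \<in> poly_ball M K J" by (simp add: poly_ball_iff)
qed

lemma poly_ball_sum_le:
  assumes "x \<in> poly_ball M K J"
  shows "(\<Sum>n<p. envelope M K (J k) \<bar>x n\<bar>) \<le> 2"
proof -
  have "(\<Sum>n<p. envelope M K (J k) \<bar>x n\<bar>) \<le> 2 - (1 / 2) ^ k"
    using assms unfolding poly_ball_iff by blast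
  also have "\<dots> \<le> 2" by simp
  finally show ?thesis .
qed

lemma poly_ball_coord:
  assumes x: "x \<in> poly_ball M K J"
  shows "\<bar>x n\<bar> \<le> C"
proof -
  have "M 1 * (\<bar>x n\<bar> - 1) \<le> envelope M K (Suc 0) \<bar>x n\<bar>" by (simp add: secant_def)
  \<comment> \<open>Level 1 is used because \<open>J 1 \<ge> 1\<close> guarantees the secant at node
    1, whereas \<open>J 0\<close> may be 0.\<close>
  also have "\<dots> \<le> envelope M K (J 1) \<bar>x n\<bar>"
    using J_ge[of 1] by (intro envelope_mono_index) simp
  also have "\<dots> \<le> (\<Sum>i<Suc n. envelope M K (J 1) \<bar>x i\<bar>)"
    by (intro member_le_sum env_nonneg) auto
  also have "\<dots> \<le> 2" by (rule poly_ball_sum_le[OF x])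
  finally have "\<bar>x n\<bar> \<le> 1 + 2 / M 1" using M1 by (simp add: field_simps)
  then show ?thesis by simp
qed

text \<open>Dilation by \<open>C\<close> makes some envelope stage dominate \<open>M\<close> at each
  coordinate, and finitely many coordinates share a level. The remaining factor 2 brings the modular
  bound 2 down to 1 by convexity.\<close>

lemma poly_ball_shrink:
  assumes x: "x \<in> poly_ball M K J"
  shows "(1 / (2 * C)) *\<^sub>R x \<in> orlicz_ball M"
  unfolding orlicz_ball_iff
proof
  fix p
  have "\<exists>j. M (\<bar>x n\<bar> / C) \<le> envelope M K j \<bar>x n\<bar>" for n
    by (rule envelope_ge[OF M K]) (use poly_ball_coord[OF x] in auto)
  then obtain j where j: "\<And>n. M (\<bar>x n\<bar> / C) \<le> envelope M K (j n) \<bar>x n\<bar>" by metis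
  \<comment> \<open>The sum is a convenient common upper bound for the finitely many stages.\<close>
  define k where "k = (\<Sum>n<p. j n)"
  have jk: "j n \<le> J k" if "n < p" for n
  proof -
    have "j n \<le> k" unfolding k_def using that by (intro member_le_sum) auto
    then show ?thesis using J_ge[of k] by simp
  qed
  have "(\<Sum>n<p. M \<bar>((1 / (2 * C)) *\<^sub>R x) n\<bar>) \<le> (\<Sum>n<p. (1 / 2) * envelope M K (J k) \<bar>x n\<bar>)"
  proof (rule sum_mono)
    fix n assume n: "n \<in> {..<p}"
    have "M \<bar>((1 / (2 * C)) *\<^sub>R x) n\<bar> = M ((1 / 2) * (\<bar>x n\<bar> / C))"
      using C_pos by (simp add: scaleR_fun_def abs_mult abs_divide)
    also have "\<dots> \<le> (1 / 2) * M (\<bar>x n\<bar> / C)"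
      using C_pos by (intro young_scale[OF M] divide_nonneg_pos) auto
    also have "\<dots> \<le> (1 / 2) * envelope M K (j n) \<bar>x n\<bar>" using j by simp
    also have "\<dots> \<le> (1 / 2) * envelope M K (J k) \<bar>x n\<bar>"
      using envelope_mono_index[OF jk] n by simp
    finally show "M \<bar>((1 / (2 * C)) *\<^sub>R x) n\<bar> \<le> (1 / 2) * envelope M K (J k) \<bar>x n\<bar>" .
  qed
  also have "\<dots> = (1 / 2) * (\<Sum>n<p. envelope M K (J k) \<bar>x n\<bar>)" by (simp add: sum_distrib_left)
  also have "\<dots> \<le> 1" using poly_ball_sum_le[OF x, of k p] by simp
  finally show "(\<Sum>n<p. M \<bar>((1 / (2 * C)) *\<^sub>R x) n\<bar>) \<le> 1" .
qed

lemma norm_ball_orlicz: "norm_ball (small_seqs M) (orlicz_ball M)"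
  using norm_ball_orlicz_ball[OF M] unbounded by blast

lemma norm_ball_poly: "norm_ball (small_seqs M) (poly_ball M K J)"
  unfolding poly_ball_def
proof (rule norm_ball_mod_ball)
  show "\<exists>\<rho>>0. (1 / \<rho>) *\<^sub>R x \<in> mod_ball (\<lambda>k. envelope M K (J k)) (\<lambda>k. 2 - (1 / 2) ^ k)"
    if "x \<in> small_seqs M" for x
    using norm_ball.absorbing[OF norm_ball_orlicz that] orlicz_ball_subset
    by (auto simp: poly_ball_def)
  show "\<bar>x n\<bar> \<le> C" if "x \<in> mod_ball (\<lambda>k. envelope M K (J k)) (\<lambda>k. 2 - (1 / 2) ^ k)" for x n
    using poly_ball_coord that by (simp add: poly_ball_def)
qed (rule subspace_small_seqs[OF M] young_env)+

section \<open>Reduction to finitely many levels and coordinates\<close>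

lemma small_seqs_tendsto_0:
  assumes v: "v \<in> small_seqs M" and \<delta>: "\<delta> > 0" and pos: "\<And>t. t > 0 \<Longrightarrow> M t > 0"
  shows "\<exists>p. \<forall>n\<ge>p. \<bar>v n\<bar> \<le> \<delta>"
proof -
  have "summable (\<lambda>n. M \<bar>v n\<bar>)" using small_seqsD[OF v, of 1] by simp
  then have "(\<lambda>n. M \<bar>v n\<bar>) \<longlonglongrightarrow> 0" by (rule summable_LIMSEQ_zero)
  \<comment> \<open>Nondegeneracy makes \<open>M \<delta>\<close> a positive bound, so the modular
    terms eventually fall below it.\<close>
  then have "\<forall>\<^sub>F n in sequentially. M \<bar>v n\<bar> < M \<delta>"
    using pos[OF \<delta>] by (rule order_tendstoD)
  then obtain p where p: "\<And>n. n \<ge> p \<Longrightarrow> M \<bar>v n\<bar> < M \<delta>"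
    by (auto simp: eventually_sequentially)
  have "\<bar>v n\<bar> \<le> \<delta>" if "n \<ge> p" for n
    using p[OF that] young_mono[OF M, of \<delta> "\<bar>v n\<bar>"] \<delta> by linarith
  then show ?thesis by blast
qed

text \<open>Past \<open>P k\<close> the envelope of level \<open>k\<close> vanishes on everything
  dominated by \<open>v\<close>. For \<open>k \<ge> k0\<close>, passing to level
  \<open>k + 1\<close> adds at most \<open>S / 4 ^ k\<close>, which is at most
  \<open>(1 / 2) ^ (k + 1)\<close>, exactly the gap between the two thresholds.\<close>

lemma finitely_determined:
  assumes v: "v \<in> small_seqs M" and pos: "\<And>t. t > 0 \<Longrightarrow> M t > 0"
  shows "\<exists>k0 P. \<forall>x. (\<forall>n. \<bar>x n\<bar> \<le> \<bar>v n\<bar>) \<longrightarrow>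
    (\<forall>k\<le>k0. (\<Sum>n<P k. envelope M K (J k) \<bar>x n\<bar>) \<le> 2 - (1 / 2) ^ k) \<longrightarrow> x \<in> poly_ball M K J"
proof -
  have "\<exists>p. \<forall>n\<ge>p. \<forall>t. \<bar>t\<bar> \<le> \<bar>v n\<bar> \<longrightarrow> envelope M K (J k) \<bar>t\<bar> = 0" for k
  proof -
    obtain \<delta> where \<delta>: "\<delta> > 0" "\<And>t. 0 \<le> t \<Longrightarrow> t \<le> \<delta> \<Longrightarrow> envelope M K (J k) t = 0"
      using envelope_eq_0_near_0[OF M, of K "J k"] K by auto
    obtain p where "\<forall>n\<ge>p. \<bar>v n\<bar> \<le> \<delta>" using small_seqs_tendsto_0[OF v \<delta>(1) pos] by blast
    then show ?thesis using \<delta>(2) by (intro exI[of _ p]) (meson abs_ge_zero order_trans)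
  qed
  then obtain P where P: "\<And>k n t. n \<ge> P k \<Longrightarrow> \<bar>t\<bar> \<le> \<bar>v n\<bar> \<Longrightarrow> envelope M K (J k) \<bar>t\<bar> = 0"
    by metis
  have sumv: "summable (\<lambda>n. M (K * \<bar>v n\<bar>))" using small_seqsD[OF v] K by simp
  define S where "S = (\<Sum>n. M (K * \<bar>v n\<bar>))"
  obtain k0 where k0: "2 * S \<le> 2 ^ k0"
    using real_arch_pow[of 2 "2 * S"] by (auto intro: less_imp_le)
  have "x \<in> poly_ball M K J"
    if dom: "\<And>n. \<bar>x n\<bar> \<le> \<bar>v n\<bar>"
      and fin: "\<And>k. k \<le> k0 \<Longrightarrow> (\<Sum>n<P k. envelope M K (J k) \<bar>x n\<bar>) \<le> 2 - (1 / 2) ^ k" for x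
  proof -
    have low: "(\<Sum>n<p. envelope M K (J k) \<bar>x n\<bar>) \<le> 2 - (1 / 2) ^ k" if k: "k \<le> k0" for k p
    proof -
      \<comment> \<open>The partial sum at \<open>P k\<close> is the largest one, so a single
        inequality settles the level.\<close>
      have "(\<Sum>n<p. envelope M K (J k) \<bar>x n\<bar>) \<le> (\<Sum>n<max p (P k). envelope M K (J k) \<bar>x n\<bar>)"
        by (intro sum_mono2 env_nonneg) auto
      also have "\<dots> = (\<Sum>n<P k. envelope M K (J k) \<bar>x n\<bar>)"
        using P[OF _ dom] by (intro sum.mono_neutral_right) auto
      finally show ?thesis using fin[OF k] by linarith
    qed
    have "(\<Sum>n<p. envelope M K (J (k0 + d)) \<bar>x n\<bar>) \<le> 2 - (1 / 2) ^ (k0 + d)" for d p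
    proof (induction d)
      case 0
      show ?case using low[of k0] by simp
    next
      case (Suc d)
      let ?k = "k0 + d"
      have "(\<Sum>n<p. envelope M K (J (Suc ?k)) \<bar>x n\<bar>)
          \<le> (\<Sum>n<p. envelope M K (J ?k) \<bar>x n\<bar> + M (K * \<bar>x n\<bar>) / 4 ^ ?k)"
        using K growth by (intro sum_mono envelope_increment[OF M]) auto
      also have "\<dots> = (\<Sum>n<p. envelope M K (J ?k) \<bar>x n\<bar>) + (\<Sum>n<p. M (K * \<bar>x n\<bar>)) / 4 ^ ?k"
        by (simp add: sum.distrib sum_divide_distrib)
      also have "(\<Sum>n<p. M (K * \<bar>x n\<bar>)) / 4 ^ ?k \<le> (1 / 2) ^ Suc ?k"
      proof -
        have "(\<Sum>n<p. M (K * \<bar>x n\<bar>)) \<le> (\<Sum>n<p. M (K * \<bar>v n\<bar>))"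
          using dom K by (intro sum_mono young_mono[OF M] mult_left_mono) auto
        also have "\<dots> \<le> S"
          unfolding S_def using K by (intro sum_le_suminf[OF sumv] young_nonneg[OF M]) auto
        finally have "2 * (\<Sum>n<p. M (K * \<bar>x n\<bar>)) \<le> 2 ^ k0" using k0 by linarith
        also have "\<dots> \<le> 2 ^ ?k" by (intro power_increasing) auto
        finally have "2 * (\<Sum>n<p. M (K * \<bar>x n\<bar>)) * 2 ^ ?k \<le> 2 ^ ?k * 2 ^ ?k"
          by (intro mult_right_mono) auto
        also have "(2::real) ^ ?k * 2 ^ ?k = 4 ^ ?k"
          by (simp flip: power_mult_distrib)
        finally show ?thesis by (simp add: field_simps)
      qed
      finally have "(\<Sum>n<p. envelope M K (J (Suc ?k)) \<bar>x n\<bar>)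
          \<le> (2 - (1 / 2) ^ ?k) + (1 / 2) ^ Suc ?k"
        using Suc.IH by linarith
      also have "\<dots> = 2 - (1 / 2) ^ Suc ?k" by simp
      finally show ?case by simp
    qed
    then have "(\<Sum>n<p. envelope M K (J k) \<bar>x n\<bar>) \<le> 2 - (1 / 2) ^ k" for k p
      using low[of k p] by (metis le_add_diff_inverse nat_le_linear)
    then show ?thesis by (simp add: poly_ball_iff)
  qed
  then show ?thesis by (intro exI[of _ k0] exI[of _ P]) blast
qed

text \<open>Domination holds on bounded sets only, so the finitely many inequalities are compared
  with the ball inside radius 2. Homogeneity then carries the comparison over to the whole
  subspace.\<close>

lemma polyhedral_on_poly_ball:
  assumes pos: "\<And>t. t > 0 \<Longrightarrow> M t > 0"
  shows "polyhedral_on (small_seqs M) (minkowski (poly_ball M K J))"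
  unfolding polyhedral_on_def
proof (intro allI impI)
  interpret norm_ball "small_seqs M" "poly_ball M K J" by (rule norm_ball_poly)
  let ?N = "minkowski (poly_ball M K J)"
  fix B assume B: "finite B \<and> B \<subseteq> small_seqs M"
  have BV: "span B \<subseteq> small_seqs M" using B V by (simp add: span_minimal)
  obtain T u where T: "finite T" and u: "u \<in> small_seqs M" "\<And>n. 0 \<le> u n"
    and dom: "\<And>x n. x \<in> span B \<Longrightarrow> \<bar>x n\<bar> \<le> (\<Sum>m\<in>T. \<bar>x m\<bar>) * u n"
    using span_dominated[OF V small_seqs_abs, of B] B by blast
  \<comment> \<open>Coordinates of points of norm at most 2 are at most \<open>2 * C\<close>;
    summing over \<open>T\<close> gives this multiple of \<open>u\<close>.\<close>
  define v where "v = (of_nat (card T) * (2 * C)) *\<^sub>R u"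
  have vV: "v \<in> small_seqs M" unfolding v_def by (intro subspace_scale V u)
  have v: "\<bar>x n\<bar> \<le> \<bar>v n\<bar>" if x: "x \<in> span B" "?N x \<le> 2" for x n
  proof -
    have "(1 / 2) *\<^sub>R x \<in> poly_ball M K J" using minkowski_mem[of x 2] x BV by auto
    then have "\<bar>((1 / 2) *\<^sub>R x) m\<bar> \<le> C" for m by (rule poly_ball_coord)
    then have "\<bar>x m\<bar> \<le> 2 * C" for m by (simp add: scaleR_fun_def mult.commute)
    then have "(\<Sum>m\<in>T. \<bar>x m\<bar>) \<le> of_nat (card T) * (2 * C)"
      by (intro sum_bounded_above) auto
    then have "(\<Sum>m\<in>T. \<bar>x m\<bar>) * u n \<le> of_nat (card T) * (2 * C) * u n"
      using u(2) by (rule mult_right_mono)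
    also have "\<dots> = v n" by (simp add: v_def scaleR_fun_def)
    also have "\<dots> \<le> \<bar>v n\<bar>" by simp
    finally show ?thesis using dom[OF x(1), of n] by linarith
  qed
  obtain k0 P where fin: "\<And>x. (\<And>n. \<bar>x n\<bar> \<le> \<bar>v n\<bar>) \<Longrightarrow>
    (\<And>k. k \<le> k0 \<Longrightarrow> (\<Sum>n<P k. envelope M K (J k) \<bar>x n\<bar>) \<le> 2 - (1 / 2) ^ k) \<Longrightarrow> x \<in> poly_ball M K J"
    using finitely_determined[OF vV pos] by metis
  define F where "F k x = (\<Sum>n<P k. envelope M K (J k) \<bar>x n\<bar>)" for k and x :: "nat \<Rightarrow> real"
  have ball_iff: "?N x \<le> 1 \<longleftrightarrow> x \<in> poly_ball M K J" if "x \<in> span B" for x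
    using minkowski_le_iff[of x 1] that BV by auto
  have N_scale: "?N (s *\<^sub>R x) = \<bar>s\<bar> * ?N x" if "x \<in> span B" for s x
    using normed_on_minkowski that BV by (auto simp: normed_on_def)
  have F_shrink: "F k (s *\<^sub>R x) \<le> F k x" if "0 \<le> s" "s \<le> 1" for k s x
    unfolding F_def using that
    by (intro sum_mono young_mono[OF young_env]) (auto simp: scaleR_fun_def abs_mult mult_left_le_one_le)
  have eq: "{x \<in> span B. ?N x \<le> 1} = {x \<in> span B. \<forall>k\<in>{..k0}. F k x \<le> 2 - (1 / 2) ^ k}"
  proof (intro equalityI subsetI CollectI conjI)
    fix x assume "x \<in> {x \<in> span B. ?N x \<le> 1}"
    then show "x \<in> span B" "\<forall>k\<in>{..k0}. F k x \<le> 2 - (1 / 2) ^ k"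
      using ball_iff[of x] by (auto simp: F_def poly_ball_iff)
  next
    fix x assume "x \<in> {x \<in> span B. \<forall>k\<in>{..k0}. F k x \<le> 2 - (1 / 2) ^ k}"
    then have x: "x \<in> span B" "\<And>k. k \<le> k0 \<Longrightarrow> F k x \<le> 2 - (1 / 2) ^ k" by auto
    then show "x \<in> span B" by simp
    show "?N x \<le> 1"
    proof (rule ccontr)
      assume N: "\<not> ?N x \<le> 1"
      \<comment> \<open>Scaling by \<open>s\<close> brings the norm of \<open>x\<close> into the
        interval from 1 (excluded) to 2. The inequalities survive shrinking, so the scaled point
        would lie in the ball.\<close>
      define s where "s = min 1 (2 / ?N x)"
      have s: "0 \<le> s" "s \<le> 1" "s * ?N x \<le> 2" "1 < s * ?N x"
        using N by (auto simp: s_def min_def field_simps)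
      have y: "s *\<^sub>R x \<in> span B" using x by (simp add: span_scale)
      have "?N (s *\<^sub>R x) \<le> 2" using N_scale[OF x(1)] s by simp
      then have "s *\<^sub>R x \<in> poly_ball M K J"
        using v[OF y] order_trans[OF F_shrink[OF s(1,2)] x(2)] unfolding F_def by (intro fin)
      then show False using ball_iff[OF y] N_scale[OF x(1)] s by simp
    qed
  qed
  have "polytope {x \<in> span B. \<forall>k\<in>{..k0}. F k x \<le> 2 - (1 / 2) ^ k}"
  proof (rule polytope_of_max_affine)
    show "max_affine (F k)" for k
      unfolding F_def using K by (intro max_affine_sum max_affine_envelope[OF M]) auto
    show "F k 0 \<le> 2 - (1 / 2) ^ k" for k
      using zero_mem by (simp only: F_def poly_ball_iff)
    show "\<exists>t>0. \<exists>k\<in>{..k0}. 2 - (1 / 2) ^ k < F k (t *\<^sub>R d)" if d: "d \<in> span B" "d \<noteq> 0" for d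
    proof -
      have Nd: "?N d > 0"
        using normed_on_minkowski d BV unfolding normed_on_def by (metis less_le subsetD)
      \<comment> \<open>Any point of the ray outside the ball violates one of the inequalities; norm
        2 is a concrete choice.\<close>
      have "?N ((2 / ?N d) *\<^sub>R d) = 2" using N_scale[OF d(1)] Nd by simp
      then have "(2 / ?N d) *\<^sub>R d \<notin> {x \<in> span B. ?N x \<le> 1}" by simp
      moreover have "(2 / ?N d) *\<^sub>R d \<in> span B" using d by (simp add: span_scale)
      ultimately have "\<exists>k\<in>{..k0}. 2 - (1 / 2) ^ k < F k ((2 / ?N d) *\<^sub>R d)"
        unfolding eq by (auto simp: not_le)
      then show ?thesis using Nd by (intro exI[of _ "2 / ?N d"]) auto
    qed
  qed (simp_all add: subspace_span)
  then show "polytope {x \<in> span B. ?N x \<le> 1}" by (simp only: eq)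
qed

text \<open>The identity is the isomorphism, with constants 1 and \<open>2 * C\<close>.\<close>

lemma isomorphically_polyhedral:
  assumes pos: "\<And>t. t > 0 \<Longrightarrow> M t > 0"
  shows "isomorphically_polyhedral_on (small_seqs M) (minkowski (orlicz_ball M))"
proof (rule isomorphically_polyhedral_onI)
  let ?H = "small_seqs M" and ?N = "minkowski (poly_ball M K J)"
  show ban: "banach_on ?H (minkowski (orlicz_ball M))"
    using banach_on_orlicz[OF M] unbounded by blast
  have le: "?N x \<le> minkowski (orlicz_ball M) x" if "x \<in> ?H" for x
    using minkowski_mono[OF norm_ball_orlicz norm_ball_poly, of 1 x] orlicz_ball_subset that
    by auto
  have ge: "minkowski (orlicz_ball M) x \<le> (2 * C) * ?N x" if "x \<in> ?H" for x
    using C_pos poly_ball_shrink that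
    by (intro minkowski_mono[OF norm_ball_poly norm_ball_orlicz]) auto
  show "banach_on ?H ?N"
    using C_pos by (intro banach_on_equivalent[OF ban _ _ le ge]
      norm_ball.normed_on_minkowski[OF norm_ball_poly]) auto
  show "polyhedral_on ?H ?N" by (rule polyhedral_on_poly_ball[OF pos])
  show "isomorphism_on ?H (minkowski (orlicz_ball M)) ?H ?N id"
    unfolding isomorphism_on_def
  proof (intro conjI)
    show "\<exists>c>0. \<forall>x\<in>?H. ?N (id x) \<le> c * minkowski (orlicz_ball M) x"
      using le by (intro exI[of _ 1]) auto
    show "\<exists>c>0. \<forall>x\<in>?H. minkowski (orlicz_ball M) x \<le> c * ?N (id x)"
      using ge C_pos by (intro exI[of _ "2 * C"]) auto
  qed auto
qed

end

section \<open>Choice of the nodes and levels\<close>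

theorem theorem4:
  fixes M :: "real \<Rightarrow> real"
  assumes "orlicz_function M" and "nondegenerate M"
    and "\<exists>K>0. filterlim (\<lambda>t. M (K * t) / M t) at_top (at_right 0)"
  shows "isomorphically_polyhedral_on (orlicz_h M) (orlicz_norm M)"
proof -
  have M: "young M" and lim: "filterlim M at_top at_top"
    using assms(1) by (auto simp: orlicz_function_def young_def)
  have pos: "M t > 0" if "t > 0" for t
    using assms(2) that by (simp add: nondegenerate_def)
  obtain K0 where K0: "K0 > 0" "filterlim (\<lambda>t. M (K0 * t) / M t) at_top (at_right 0)"
    using assms(3) by blast
  \<comment> \<open>Enlarging the dilation preserves the growth because \<open>M\<close> is
    monotone; the value 2 is what \<open>envelope_ge\<close> requires.\<close>
  define K where "K = max K0 2"
  have "\<exists>J\<ge>k. \<forall>j\<ge>J. 4 ^ k * M ((1 / K) ^ j) \<le> M (K * (1 / K) ^ j)" for k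
  proof -
    have "\<forall>\<^sub>F t in at_right 0. 4 ^ k \<le> M (K0 * t) / M t"
      using K0(2) by (simp add: filterlim_at_top)
    then obtain d where d: "d > 0" "\<And>t. 0 < t \<Longrightarrow> t < d \<Longrightarrow> 4 ^ k \<le> M (K0 * t) / M t"
      unfolding eventually_at_right_field by auto
    have "1 / K < 1" by (simp add: K_def)
    then obtain J0 where J0: "(1 / K) ^ J0 < d"
      using real_arch_pow_inv[OF d(1)] by blast
    \<comment> \<open>From \<open>J0\<close> on the nodes lie where the ratio is at least
      \<open>4 ^ k\<close>; the maximum with \<open>k\<close> provides
      \<open>J k \<ge> k\<close>.\<close>
    have "4 ^ k * M ((1 / K) ^ j) \<le> M (K * (1 / K) ^ j)" if "j \<ge> max k J0" for j
    proof -
      define t where "t = (1 / K) ^ j"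
      have t0: "t > 0" by (simp add: t_def K_def)
      have "t \<le> (1 / K) ^ J0" unfolding t_def using that by (intro power_decreasing) (auto simp: K_def)
      then have "4 ^ k \<le> M (K0 * t) / M t" using d(2) t0 J0 by simp
      then have "4 ^ k * M t \<le> M (K0 * t)" using pos[OF t0] by (simp add: field_simps)
      also have "\<dots> \<le> M (K * t)"
        using K0(1) t0 by (intro young_mono[OF M] mult_right_mono) (auto simp: K_def)
      finally show ?thesis by (simp add: t_def)
    qed
    then show ?thesis by (intro exI[of _ "max k J0"]) auto
  qed
  then obtain J where J: "\<And>k. J k \<ge> k"
    "\<And>k j. j \<ge> J k \<Longrightarrow> 4 ^ k * M ((1 / K) ^ j) \<le> M (K * (1 / K) ^ j)"
    by metis
  have "\<forall>\<^sub>F t in at_top. M t > 1"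
    using lim by (simp add: filterlim_at_top_dense)
  then obtain R where R: "\<And>t. t \<ge> R \<Longrightarrow> M t > 1"
    unfolding eventually_at_top_linorder by blast
  interpret fast_orlicz M K J
  proof
    show "\<exists>R>0. M R > 1" by (rule exI[of _ "max 1 R"]) (simp add: R)
    show "2 \<le> K" by (simp add: K_def)
    show "M 1 > 0" by (rule pos) simp
  qed (fact M J)+
  show ?thesis
    using isomorphically_polyhedral[OF pos]
    by (simp only: orlicz_h_eq[OF M] orlicz_norm_eq_minkowski[OF M])
qed

end
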